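(* Let $A_{-1},A_0,A_1$ be the semi-infinite matrices described in the context, and assume that $A_{-1}\mathbf 1>A_1\mathbf 1$. Let $G$ be the minimal nonnegative solution of $A_1X^2+A_0X+A_{-1}=X$. Define \[ F_1(X)=A_{-1}+A_0X+A_1X^2,\quad F_2(X)=(I-A_0)^{-1}(A_{-1}+A_1X^2),\quad F_3(X)=(I-A_0-A_1X)^{-1}A_{-1}. \] For $i\in\{1,2,3\}$ define $X_{k+1}^{(i)}=F_i(X_k^{(i)})$, $k=0,1,2,\ldots$, where $X_0^{(i)}\ge0$ and $X_0^{(i)}\mathbf 1=\mathbf 1$. Then 1. the three sequences $\{X_k^{(i)}\}$ are well defined; 2. $X_k^{(i)}\ge0$ and $X_k^{(i)}\mathbf 1=\mathbf 1$; 3. for the error $\mathcal E_k^{(i)}=G-X_k^{(i)}$ the following holds: $\mathcal E_k^{(i)}\mathbf 1=0$, and for any other eigenvector $w\ne\mathbf 1$ of $G$ such that $Gw=\lambda w$, the sequence $w_k^{(i)}=\mathcal E_k^{(i)}w$ satisfies \[ \|w_{k+1}^{(i)}\|_\infty\le\|H_i(\lambda)\|_\infty\|w_k^{(i)}\|_\infty,\qquad i=1,2, \] where $H_1(\lambda)=(|\lambda|+1)A_1+A_0$ and $H_2(\lambda)=(|\lambda|+1)(I-A_0)^{-1}A_1$. Moreover, \[ \|w_{k+1}^{(3)}\|_\infty\le|\lambda|\cdot\|(I-A_0-A_1X_k^{(3)})^{-1}A_1\|_\infty\,\|w_k^{(3)}\|_\infty , \] and \[ \limsup_{k}\frac{\|w_{k+1}^{(3)}\|_\infty}{\|w_k^{(3)}\|_\infty}\le|\lambda|.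 \]
   Context: For $i=-1,0,1$, $A_i$ is the semi-infinite tridiagonal matrix (rows and columns indexed by $1,2,\ldots$) whose first row is $[b_{i,0},b_{i,1},0,\ldots]$ and whose $r$-th row, $r\ge2$, has entries $a_{i,-1},a_{i,0},a_{i,1}$ in columns $r-1,r,r+1$ and zeros elsewhere. Here $a_{i,j}\ge0$, $b_{i,j}\ge0$, $\sum_{i,j=-1}^1a_{i,j}=1$ and $\sum_{i=-1}^1\sum_{j=0}^1b_{i,j}=1$. Hence $(A_{-1}+A_0+A_1)\mathbf 1=\mathbf 1$, where $\mathbf 1$ is the infinite vector of all ones. It is also assumed throughout that there exists $i$ such that $a_{i,j}\ne0$ for at least two values of $j$. Inequalities between vectors and matrices are entrywise. $\ell^\infty$ is the space of bounded sequences with $\|x\|_\infty=\sup_i|x_i|$. $\mathcal L_\infty$ is the Banach algebra of semi-infinite matrices $A=(a_{i,j})$ that define bounded operators $\ell^\infty\to\ell^\infty$, with norm $\|A\|_\infty=\sup_i\sum_j|a_{i,j}|$; $I$ is the identity matrix, inverses are taken in $\mathcal L_\infty$, and eigenvectors of $G$ are eigenvectors in $\ell^\infty$. A solution $X\ge0$ of a matrix equation is minimal nonnegative if $Y-X\ge0$ for every other nonnegative solution $Y$. It is known that the minimal nonnegative solution $G$ of $A_1X^2+A_0X+A_{-1}=X$ exists and that $G\mathbf 1\le\mathbf 1$. *)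

theory Defs
  imports
    "HOL-Analysis.Analysis"
    "HOL-Algebra.Group"
    "HOL-Library.Function_Algebras"
begin

text \<open>
  Rows and columns are numbered from 0. Addition, subtraction, \<^term>\<open>0\<close> and \<open>\<le>\<close> of vectors
  and matrices are the library's pointwise operations on functions. Strict inequality is not: the
  library's \<open><\<close> on functions is not entrywise, so entrywise strictness is always written out.
\<close>

type_synonym smat = "nat \<Rightarrow> nat \<Rightarrow> real"

definition ones :: "nat \<Rightarrow> 'a::one" where
  "ones = (\<lambda>_. 1)"

definition ell_inf :: "(nat \<Rightarrow> 'a::real_normed_vector) set" where
  "ell_inf = {x. bounded (range x)}"

definition vnorm :: "(nat \<Rightarrow> 'a::real_normed_vector) \<Rightarrow> real" where
  "vnorm x = (SUP i. norm (x i))"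

text \<open>
  All matrices of interest are real, but eigenvalues and eigenvectors may be complex; the action
  of a real matrix is therefore defined on real and complex sequences alike.
\<close>

definition mat_vec :: "smat \<Rightarrow> (nat \<Rightarrow> 'a::real_normed_vector) \<Rightarrow> nat \<Rightarrow> 'a"  (infixr "\<triangleright>" 70) where
  "A \<triangleright> x = (\<lambda>i. \<Sum>\<^sub>\<infinity>j. A i j *\<^sub>R x j)"

definition mat_mult :: "smat \<Rightarrow> smat \<Rightarrow> smat"  (infixl "\<star>" 70) where
  "A \<star> B = (\<lambda>i j. \<Sum>\<^sub>\<infinity>k. A i k * B k j)"

definition mat_scale :: "real \<Rightarrow> smat \<Rightarrow> smat" where
  "mat_scale c A = (\<lambda>i j. c * A i j)"

definition mat_id :: smat where
  "mat_id = (\<lambda>i j. if i = j then 1 else 0)"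

definition Linf :: "smat set" where
  "Linf = {A. \<exists>C. \<forall>x \<in> (ell_inf :: (nat \<Rightarrow> complex) set).
     (\<forall>i. (\<lambda>j. A i j *\<^sub>R x j) summable_on UNIV) \<and>
     A \<triangleright> x \<in> ell_inf \<and> vnorm (A \<triangleright> x) \<le> C * vnorm x}"

definition mnorm :: "smat \<Rightarrow> real" where
  "mnorm A = (SUP i. \<Sum>\<^sub>\<infinity>j. \<bar>A i j\<bar>)"

definition Linf_monoid :: "smat monoid" where
  "Linf_monoid = \<lparr>carrier = Linf, mult = (\<star>), one = mat_id\<rparr>"

text \<open>\<open>a i j\<close> and \<open>b i j\<close> are used only for \<open>i, j \<in> {-1, 0, 1}\<close> and for
  \<open>i \<in> {-1, 0, 1}\<close>, \<open>j \<in> {0, 1}\<close>, respectively.\<close>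

definition qbd_block :: "(int \<Rightarrow> int \<Rightarrow> real) \<Rightarrow> (int \<Rightarrow> int \<Rightarrow> real) \<Rightarrow> int \<Rightarrow> smat" where
  "qbd_block a b i = (\<lambda>r c.
     if r = 0 then (if c \<le> 1 then b i (int c) else 0)
     else (if \<bar>int c - int r\<bar> \<le> 1 then a i (int c - int r) else 0))"

text \<open>
  A solution need not lie in \<open>Linf\<close>. The convergence condition keeps out matrices whose square
  does not exist, since a divergent infinite sum has the default value 0; the other products have
  finite sums as entries, because the \<open>A i\<close> are banded.
\<close>

definition nonneg_solution :: "(int \<Rightarrow> smat) \<Rightarrow> smat \<Rightarrow> bool" where
  "nonneg_solution A Y \<longleftrightarrow> 0 \<le> Y \<and>
     (\<forall>i j. (\<lambda>k. Y i k * Y k j) summable_on UNIV) \<and>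
     A 1 \<star> (Y \<star> Y) + A 0 \<star> Y + A (-1) = Y"

definition minimal_nonneg_solution :: "(int \<Rightarrow> smat) \<Rightarrow> smat \<Rightarrow> bool" where
  "minimal_nonneg_solution A Y \<longleftrightarrow>
     nonneg_solution A Y \<and> (\<forall>Z. nonneg_solution A Z \<longrightarrow> 0 \<le> Z - Y)"

definition F1 :: "(int \<Rightarrow> smat) \<Rightarrow> smat \<Rightarrow> smat" where
  "F1 A X = A (-1) + A 0 \<star> X + A 1 \<star> (X \<star> X)"

definition F2 :: "(int \<Rightarrow> smat) \<Rightarrow> smat \<Rightarrow> smat" where
  "F2 A X = inv\<^bsub>Linf_monoid\<^esub> (mat_id - A 0) \<star> (A (-1) + A 1 \<star> (X \<star> X))"

definition F3 :: "(int \<Rightarrow> smat) \<Rightarrow> smat \<Rightarrow> smat" where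
  "F3 A X = inv\<^bsub>Linf_monoid\<^esub> (mat_id - A 0 - A 1 \<star> X) \<star> A (-1)"

definition H1 :: "(int \<Rightarrow> smat) \<Rightarrow> complex \<Rightarrow> smat" where
  "H1 A \<mu> = mat_scale (cmod \<mu> + 1) (A 1) + A 0"

definition H2 :: "(int \<Rightarrow> smat) \<Rightarrow> complex \<Rightarrow> smat" where
  "H2 A \<mu> = mat_scale (cmod \<mu> + 1) (inv\<^bsub>Linf_monoid\<^esub> (mat_id - A 0) \<star> A 1)"

end

theory Submission imports Defs begin

text \<open>
  Write s_i for the vector of row sums of \<open>A i\<close>, so that s_{-1} + s_0 + s_1 = 1. Each s_i takes only
  two values, hence the drift condition gives s_0 + 2 s_1 \<open>\<le> \<theta> < 1\<close> uniformly in the row. Neumann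
  series of nonnegative matrices with row sums at most \<open>\<theta>\<close> then yield the inverses in F_2 and F_3,
  and these are nonnegative.

  Minimality bounds G by the limit of the functional iteration from 0, which is substochastic. The
  defect u = 1 - G1 therefore satisfies 0 \<open>\<le>\<close> u \<open>\<le>\<close> 1 and u = A_0 u + A_1 u + A_1 G u, so its supremum m
  satisfies m \<open>\<le> \<theta>\<close> m; thus u = 0 and G is stochastic.

  With E = G - X, the identity G^2 - X^2 = E G + X E expresses the next error as
  A_0 E + A_1 (E G + X E), as (I - A_0)^{-1} A_1 (E G + X E), and as (I - A_0 - A_1 X)^{-1} A_1 E G,
  respectively. On an eigenvector w of G the factor G becomes the scalar \<open>\<mu>\<close>, and X does not increase
  the norm.
\<close>

no_notation Infinite_Set_Sum.abs_summable_on (infix \<open>abs'_summable'_on\<close> 50)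

section \<open>The algebra of bounded semi-infinite matrices\<close>

lemma ell_infI: "(\<And>i. norm (x i) \<le> C) \<Longrightarrow> x \<in> ell_inf"
  unfolding ell_inf_def by (auto intro!: boundedI)

lemma norm_le_vnorm: "x \<in> ell_inf \<Longrightarrow> norm (x i) \<le> vnorm x"
  unfolding ell_inf_def vnorm_def
  by (rule cSUP_upper) (auto simp: bounded_iff bdd_above_def)

lemma vnorm_le: "(\<And>i. norm (x i) \<le> C) \<Longrightarrow> vnorm x \<le> C"
  unfolding vnorm_def by (rule cSUP_least) auto

lemma vnorm_nonneg: "x \<in> ell_inf \<Longrightarrow> 0 \<le> vnorm x"
  using norm_le_vnorm norm_ge_zero order_trans by blast

lemma ell_inf_add: "x \<in> ell_inf \<Longrightarrow> y \<in> ell_inf \<Longrightarrow> x + y \<in> ell_inf"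
  by (rule ell_infI[of _ "vnorm x + vnorm y"])
    (auto intro!: norm_triangle_le add_mono norm_le_vnorm)

lemma ell_inf_diff: "x \<in> ell_inf \<Longrightarrow> y \<in> ell_inf \<Longrightarrow> x - y \<in> ell_inf"
  by (rule ell_infI[of _ "vnorm x + vnorm y"])
    (auto intro!: norm_triangle_le_diff add_mono norm_le_vnorm)

lemma ones_ell_inf: "(ones :: nat \<Rightarrow> 'a::real_normed_algebra_1) \<in> ell_inf"
  by (rule ell_infI[of _ 1]) (simp add: ones_def)

lemma ell_inf_cmult:
  fixes w :: "nat \<Rightarrow> 'a::real_normed_algebra"
  assumes "w \<in> ell_inf"
  shows "(\<lambda>i. c * w i) \<in> ell_inf"
  by (rule ell_infI[of _ "norm c * vnorm w"])
    (meson assms mult_left_mono norm_ge_zero norm_le_vnorm norm_mult_ineq order_trans)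

lemma vnorm_cmult_le:
  fixes w :: "nat \<Rightarrow> 'a::real_normed_algebra"
  assumes "w \<in> ell_inf"
  shows "vnorm (\<lambda>i. c * w i) \<le> norm c * vnorm w"
  by (rule vnorm_le)
    (meson assms mult_left_mono norm_ge_zero norm_le_vnorm norm_mult_ineq order_trans)

section \<open>Membership in \<open>Linf\<close> in terms of absolute row sums\<close>

text \<open>Test on the constant sequence 1; for scalar families summability and absolute
  summability coincide.\<close>

lemma Linf_row_abs_summable:
  assumes "A \<in> Linf"
  shows "(\<lambda>j. A i j) abs_summable_on UNIV"
proof -
  have "(\<lambda>j. A i j *\<^sub>R (ones :: nat \<Rightarrow> complex) j) summable_on UNIV"
    using assms ones_ell_inf unfolding Linf_def by blast
  then show ?thesis
    by (simp add: summable_on_iff_abs_summable_on_complex ones_def)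
qed

text \<open>The sequence of signs of row i has norm at most 1, and entry i of its image is exactly
  the absolute row sum, so the operator bound controls every row.\<close>

lemma Linf_row_bound:
  assumes "A \<in> Linf"
  obtains C where "\<And>i. (\<Sum>\<^sub>\<infinity>j. \<bar>A i j\<bar>) \<le> C"
proof -
  obtain C where C: "\<And>x. x \<in> (ell_inf :: (nat \<Rightarrow> complex) set) \<Longrightarrow>
      A \<triangleright> x \<in> ell_inf \<and> vnorm (A \<triangleright> x) \<le> C * vnorm x"
    using assms unfolding Linf_def by blast
  have "(\<Sum>\<^sub>\<infinity>j. \<bar>A i j\<bar>) \<le> \<bar>C\<bar>" for i
  proof -
    define x :: "nat \<Rightarrow> complex" where "x j = of_real (sgn (A i j))" for j
    have nx: "norm (x j) \<le> 1" for j by (simp add: x_def abs_sgn_eq)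
    have x: "x \<in> ell_inf" using nx by (rule ell_infI)
    have "A i j *\<^sub>R x j = of_real \<bar>A i j\<bar>" for j
      by (simp add: x_def scaleR_conv_of_real abs_sgn flip: of_real_mult)
    then have "(A \<triangleright> x) i = (\<Sum>\<^sub>\<infinity>j. of_real \<bar>A i j\<bar>)" by (simp add: mat_vec_def)
    also have "\<dots> = of_real (\<Sum>\<^sub>\<infinity>j. \<bar>A i j\<bar>)"
      using Linf_row_abs_summable[OF assms, of i]
      by (intro infsumI has_sum_of_real) simp
    finally have "\<bar>\<Sum>\<^sub>\<infinity>j. \<bar>A i j\<bar>\<bar> = norm ((A \<triangleright> x) i)" by simp
    also have "\<dots> \<le> C * vnorm x"
      using C[OF x] norm_le_vnorm[of "A \<triangleright> x" i] by linarith
    \<comment> \<open>\<open>C\<close> has no known sign and \<open>x\<close> vanishes on a zero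
      row, so the product is compared with the absolute value of \<open>C\<close> times 1.\<close>
    also have "\<dots> \<le> \<bar>C\<bar> * 1"
      using vnorm_le[OF nx] vnorm_nonneg[OF x] by (intro mult_mono) auto
    finally show ?thesis by linarith
  qed
  then show ?thesis using that by blast
qed

lemma norm_scaleR_sum_bound:
  fixes x :: "nat \<Rightarrow> 'a::banach"
  assumes "f abs_summable_on UNIV" "x \<in> ell_inf"
  shows "(\<lambda>j. f j *\<^sub>R x j) abs_summable_on UNIV"
    and "norm (\<Sum>\<^sub>\<infinity>j. f j *\<^sub>R x j) \<le> (\<Sum>\<^sub>\<infinity>j. \<bar>f j\<bar>) * vnorm x"
proof -
  have le: "norm (f j *\<^sub>R x j) \<le> \<bar>f j\<bar> * vnorm x" for j
    using norm_le_vnorm[OF assms(2), of j] by (simp add: mult_left_mono)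
  have s: "(\<lambda>j. \<bar>f j\<bar> * vnorm x) summable_on UNIV"
    using assms(1) by (intro summable_on_cmult_left) simp
  show sum: "(\<lambda>j. f j *\<^sub>R x j) abs_summable_on UNIV"
    by (rule Infinite_Sum.abs_summable_on_comparison_test'[OF s]) (rule le)
  have "norm (\<Sum>\<^sub>\<infinity>j. f j *\<^sub>R x j) \<le> (\<Sum>\<^sub>\<infinity>j. norm (f j *\<^sub>R x j))"
    by (rule norm_infsum_bound[OF sum])
  also have "\<dots> \<le> (\<Sum>\<^sub>\<infinity>j. \<bar>f j\<bar> * vnorm x)"
    by (rule infsum_mono[OF sum s le])
  also have "\<dots> = (\<Sum>\<^sub>\<infinity>j. \<bar>f j\<bar>) * vnorm x"
    by (rule infsum_cmult_left')
  finally show "norm (\<Sum>\<^sub>\<infinity>j. f j *\<^sub>R x j) \<le> (\<Sum>\<^sub>\<infinity>j. \<bar>f j\<bar>) * vnorm x" .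
qed

text \<open>Together with \<open>Linf_row_bound\<close> this replaces the operator definition of
  \<open>Linf\<close> by a uniform bound on absolute row sums.\<close>

lemma LinfI:
  assumes s: "\<And>i. (\<lambda>j. A i j) abs_summable_on UNIV"
    and le: "\<And>i. (\<Sum>\<^sub>\<infinity>j. \<bar>A i j\<bar>) \<le> C"
  shows "A \<in> Linf"
proof -
  have "(\<forall>i. (\<lambda>j. A i j *\<^sub>R x j) summable_on UNIV) \<and>
     A \<triangleright> x \<in> ell_inf \<and> vnorm (A \<triangleright> x) \<le> C * vnorm x"
    if x: "x \<in> ell_inf" for x :: "nat \<Rightarrow> complex"
  proof -
    have b: "norm ((A \<triangleright> x) i) \<le> C * vnorm x" for i
      unfolding mat_vec_def
      using norm_scaleR_sum_bound(2)[OF s[of i] x] mult_right_mono[OF le[of i] vnorm_nonneg[OF x]]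
      by linarith
    show ?thesis
      using abs_summable_summable[OF norm_scaleR_sum_bound(1)[OF s x]]
      by (auto intro: ell_infI vnorm_le b)
  qed
  then show ?thesis unfolding Linf_def by blast
qed

lemma row_sum_le_mnorm:
  assumes "A \<in> Linf"
  shows "(\<Sum>\<^sub>\<infinity>j. \<bar>A i j\<bar>) \<le> mnorm A"
proof -
  obtain C where "\<And>i. (\<Sum>\<^sub>\<infinity>j. \<bar>A i j\<bar>) \<le> C" using Linf_row_bound[OF assms] by blast
  then show ?thesis
    unfolding mnorm_def by (intro cSUP_upper) (auto simp: bdd_above_def)
qed

lemma mnorm_nonneg: "A \<in> Linf \<Longrightarrow> 0 \<le> mnorm A"
  using row_sum_le_mnorm[of A 0] infsum_nonneg[of UNIV "\<lambda>j. \<bar>A 0 j\<bar>"] by simp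

lemma mat_vec_abs_summable:
  fixes x :: "nat \<Rightarrow> 'a::banach"
  assumes "A \<in> Linf" "x \<in> ell_inf"
  shows "(\<lambda>j. A i j *\<^sub>R x j) abs_summable_on UNIV"
  using norm_scaleR_sum_bound(1)[OF Linf_row_abs_summable[OF assms(1)] assms(2)] .

lemma mat_vec_summable:
  fixes x :: "nat \<Rightarrow> 'a::banach"
  assumes "A \<in> Linf" "x \<in> ell_inf"
  shows "(\<lambda>j. A i j *\<^sub>R x j) summable_on UNIV"
  using abs_summable_summable[OF mat_vec_abs_summable[OF assms]] .

lemma norm_mat_vec_le_row:
  fixes x :: "nat \<Rightarrow> 'a::banach"
  assumes "A \<in> Linf" "x \<in> ell_inf"
  shows "norm ((A \<triangleright> x) i) \<le> (\<Sum>\<^sub>\<infinity>j. \<bar>A i j\<bar>) * vnorm x"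
  unfolding mat_vec_def
  using norm_scaleR_sum_bound(2)[OF Linf_row_abs_summable[OF assms(1)] assms(2)] .

lemma norm_mat_vec_le:
  fixes x :: "nat \<Rightarrow> 'a::banach"
  assumes "A \<in> Linf" "x \<in> ell_inf"
  shows "norm ((A \<triangleright> x) i) \<le> mnorm A * vnorm x"
  using norm_mat_vec_le_row[OF assms, of i]
    mult_right_mono[OF row_sum_le_mnorm[OF assms(1), of i] vnorm_nonneg[OF assms(2)]]
  by linarith

lemma mat_vec_ell_inf:
  fixes x :: "nat \<Rightarrow> 'a::banach"
  assumes "A \<in> Linf" "x \<in> ell_inf"
  shows "A \<triangleright> x \<in> ell_inf"
  using norm_mat_vec_le[OF assms] by (rule ell_infI)

lemma vnorm_mat_vec_le:
  fixes x :: "nat \<Rightarrow> 'a::banach"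
  assumes "A \<in> Linf" "x \<in> ell_inf"
  shows "vnorm (A \<triangleright> x) \<le> mnorm A * vnorm x"
  using norm_mat_vec_le[OF assms] by (rule vnorm_le)

lemma mat_vec_add_right:
  fixes x y :: "nat \<Rightarrow> 'a::banach"
  assumes "A \<in> Linf" "x \<in> ell_inf" "y \<in> ell_inf"
  shows "A \<triangleright> (x + y) = A \<triangleright> x + A \<triangleright> y"
  unfolding mat_vec_def plus_fun_def scaleR_add_right
  by (intro ext infsum_add mat_vec_summable assms)

lemma mat_vec_add_left:
  fixes x :: "nat \<Rightarrow> 'a::banach"
  assumes "A \<in> Linf" "B \<in> Linf" "x \<in> ell_inf"
  shows "(A + B) \<triangleright> x = A \<triangleright> x + B \<triangleright> x"
  unfolding mat_vec_def plus_fun_def scaleR_add_left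
  by (intro ext infsum_add mat_vec_summable assms)

lemma Linf_add:
  assumes "A \<in> Linf" "B \<in> Linf"
  shows "A + B \<in> Linf"
proof -
  obtain C D where C: "\<And>i. (\<Sum>\<^sub>\<infinity>j. \<bar>A i j\<bar>) \<le> C" and D: "\<And>i. (\<Sum>\<^sub>\<infinity>j. \<bar>B i j\<bar>) \<le> D"
    using Linf_row_bound assms by metis
  note s = Linf_row_abs_summable[OF assms(1), simplified] Linf_row_abs_summable[OF assms(2), simplified]
  note s' = summable_on_add[OF s]
  have t: "(\<lambda>j. (A + B) i j) abs_summable_on UNIV" for i
    by (rule Infinite_Sum.abs_summable_on_comparison_test'[OF s'[of i i]]) simp
  show ?thesis
  proof (rule LinfI[OF t])
    fix i
    have "(\<Sum>\<^sub>\<infinity>j. \<bar>(A + B) i j\<bar>) \<le> (\<Sum>\<^sub>\<infinity>j. \<bar>A i j\<bar> + \<bar>B i j\<bar>)"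
      using t[of i] by (intro infsum_mono s') auto
    also have "\<dots> \<le> C + D" by (subst infsum_add[OF s]) (intro add_mono C D)
    finally show "(\<Sum>\<^sub>\<infinity>j. \<bar>(A + B) i j\<bar>) \<le> C + D" .
  qed
qed

lemma abs_row_sum_scale: "(\<Sum>\<^sub>\<infinity>j. \<bar>mat_scale c A i j\<bar>) = \<bar>c\<bar> * (\<Sum>\<^sub>\<infinity>j. \<bar>A i j\<bar>)"
  unfolding mat_scale_def by (simp add: abs_mult infsum_cmult_right')

lemma Linf_scale:
  assumes "A \<in> Linf"
  shows "mat_scale c A \<in> Linf"
proof -
  obtain C where C: "\<And>i. (\<Sum>\<^sub>\<infinity>j. \<bar>A i j\<bar>) \<le> C" using Linf_row_bound assms by metis
  have "(\<lambda>j. mat_scale c A i j) abs_summable_on UNIV" for i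
    using Linf_row_abs_summable[OF assms, of i]
    by (simp add: mat_scale_def abs_mult summable_on_cmult_right)
  then show ?thesis
    by (rule LinfI[where C = "\<bar>c\<bar> * C"]) (simp add: abs_row_sum_scale mult_left_mono C)
qed

lemma uminus_eq_mat_scale: "- A = mat_scale (-1) A"
  by (simp add: mat_scale_def fun_eq_iff)

lemma Linf_diff: "A \<in> Linf \<Longrightarrow> B \<in> Linf \<Longrightarrow> A - B \<in> Linf"
  using Linf_add[of A "- B"] Linf_scale[of B "-1"] by (simp flip: uminus_eq_mat_scale)

lemma mat_vec_diff_right:
  fixes x y :: "nat \<Rightarrow> 'a::banach"
  assumes "A \<in> Linf" "x \<in> ell_inf" "y \<in> ell_inf"
  shows "A \<triangleright> (x - y) = A \<triangleright> x - A \<triangleright> y"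
  using mat_vec_add_right[OF assms(1) ell_inf_diff[OF assms(2,3)] assms(3)] by simp

lemma mat_vec_diff_left:
  fixes x :: "nat \<Rightarrow> 'a::banach"
  assumes "A \<in> Linf" "B \<in> Linf" "x \<in> ell_inf"
  shows "(A - B) \<triangleright> x = A \<triangleright> x - B \<triangleright> x"
  using mat_vec_add_left[OF Linf_diff[OF assms(1,2)] assms(2,3)] by simp

lemma mat_vec_cmult:
  fixes x :: "nat \<Rightarrow> 'a::{real_normed_div_algebra}"
  shows "A \<triangleright> (\<lambda>i. c * x i) = (\<lambda>i. c * (A \<triangleright> x) i)"
  unfolding mat_vec_def by (simp add: infsum_cmult_right' flip: mult_scaleR_right)

lemma mat_vec_finite_row:
  assumes "finite S" "\<And>j. j \<notin> S \<Longrightarrow> A i j = 0"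
  shows "(A \<triangleright> x) i = (\<Sum>j\<in>S. A i j *\<^sub>R x j)"
  unfolding mat_vec_def using assms by (subst infsum_cong_neutral[where T = S and g = "\<lambda>j. A i j *\<^sub>R x j"]) auto

lemma mat_vec_id: "mat_id \<triangleright> x = x"
  by (rule ext, subst mat_vec_finite_row[where S = "{_}"]) (auto simp: mat_id_def)

lemma Linf_id: "mat_id \<in> Linf"
proof (rule LinfI[where C = 1])
  fix i
  have "((\<lambda>j. \<bar>mat_id i j\<bar>) has_sum 1) UNIV"
    by (rule has_sum_finite_neutralI[where B = "{i}"]) (auto simp: mat_id_def)
  then show "(\<lambda>j. mat_id i j) abs_summable_on UNIV" "(\<Sum>\<^sub>\<infinity>j. \<bar>mat_id i j\<bar>) \<le> 1"
    by (auto simp: has_sum_iff)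
qed

text \<open>An entry is bounded by its absolute row sum. Products act on columns, so this lets the
  laws of \<open>\<star>\<close> be read off from those of \<open>\<triangleright>\<close>.\<close>

lemma column_ell_inf:
  assumes "A \<in> Linf"
  shows "(\<lambda>i. A i j) \<in> ell_inf"
proof -
  obtain C where C: "\<And>i. (\<Sum>\<^sub>\<infinity>j. \<bar>A i j\<bar>) \<le> C" using Linf_row_bound assms by metis
  have "norm (A i j) \<le> C" for i
  proof -
    have "sum (\<lambda>j. \<bar>A i j\<bar>) {j} \<le> (\<Sum>\<^sub>\<infinity>j. \<bar>A i j\<bar>)"
      using Linf_row_abs_summable[OF assms, of i] by (intro finite_sum_le_infsum) auto
    then show ?thesis using C[of i] by simp
  qed
  then show ?thesis by (rule ell_infI)
qed

section \<open>The matrix product and the monoid \<open>Linf\<close>\<close>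

lemma mat_mult_conv_mat_vec: "(A \<star> B) i j = (A \<triangleright> (\<lambda>k. B k j)) i"
  by (simp add: mat_mult_def mat_vec_def)

text \<open>Fubini for the family A_ik B_kj x_j. It is absolutely summable over all pairs because x
  is bounded and the absolute row sums of B are bounded uniformly in k, which leaves a multiple of
  row i of A to be summed.\<close>

lemma mat_mult_vec_aux:
  fixes x :: "nat \<Rightarrow> 'a::banach"
  assumes A: "A \<in> Linf" and B: "B \<in> Linf" and x: "x \<in> ell_inf"
  shows "(\<lambda>j. (A \<star> B) i j *\<^sub>R x j) summable_on UNIV"
    and "((A \<star> B) \<triangleright> x) i = (A \<triangleright> (B \<triangleright> x)) i"
proof -
  define f where "f = (\<lambda>(k, j). (A i k * B k j) *\<^sub>R x j)"
  obtain C where C: "\<And>i. (\<Sum>\<^sub>\<infinity>j. \<bar>B i j\<bar>) \<le> C" using Linf_row_bound B by metis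
  have inner: "(\<lambda>j. f (k, j)) abs_summable_on UNIV" for k
    using summable_on_cmult_right[OF mat_vec_abs_summable[OF B x, of k], of "\<bar>A i k\<bar>"]
    by (simp add: f_def abs_mult mult.assoc)
  have le: "norm (\<Sum>\<^sub>\<infinity>j. norm (f (k, j))) \<le> \<bar>A i k\<bar> * (C * vnorm x)" for k
  proof -
    have s: "(\<lambda>j. \<bar>B k j\<bar> * vnorm x) summable_on UNIV"
      using Linf_row_abs_summable[OF B, of k] by (intro summable_on_cmult_left) simp
    have "(\<Sum>\<^sub>\<infinity>j. norm (f (k, j))) \<le> (\<Sum>\<^sub>\<infinity>j. \<bar>A i k\<bar> * (\<bar>B k j\<bar> * vnorm x))"
      by (intro infsum_mono inner summable_on_cmult_right s)
        (simp add: f_def abs_mult mult.assoc mult_left_mono norm_le_vnorm[OF x])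
    also have "\<dots> = \<bar>A i k\<bar> * ((\<Sum>\<^sub>\<infinity>j. \<bar>B k j\<bar>) * vnorm x)"
      by (simp only: infsum_cmult_left' infsum_cmult_right')
    also have "\<dots> \<le> \<bar>A i k\<bar> * (C * vnorm x)"
      by (intro mult_left_mono mult_right_mono C vnorm_nonneg[OF x]) auto
    finally show ?thesis by (simp add: infsum_nonneg)
  qed
  have outer: "(\<lambda>k. \<bar>A i k\<bar> * (C * vnorm x)) summable_on UNIV"
    using Linf_row_abs_summable[OF A, of i] by (intro summable_on_cmult_left) simp
  have "f abs_summable_on UNIV \<times> UNIV"
    unfolding Infinite_Sum.abs_summable_on_Sigma_iff
    using inner Infinite_Sum.abs_summable_on_comparison_test'[OF outer le] by blast
  then have f: "f summable_on UNIV \<times> UNIV" by (rule abs_summable_summable)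
  \<comment> \<open>With the index pair swapped, the inner sum runs over k and produces the entries
    of the product.\<close>
  have f': "(\<lambda>(j, k). f (k, j)) summable_on UNIV \<times> UNIV"
    using summable_on_swap[of f UNIV UNIV] f by (simp add: prod.swap_def case_prod_unfold)
  have eq: "(\<Sum>\<^sub>\<infinity>k. f (k, j)) = (A \<star> B) i j *\<^sub>R x j" for j
  proof -
    have "(\<lambda>k. A i k * B k j) summable_on UNIV"
      using mat_vec_summable[OF A column_ell_inf[OF B]] by simp
    then show ?thesis
      unfolding f_def mat_mult_def by (simp add: infsum_scaleR_left)
  qed
  show "(\<lambda>j. (A \<star> B) i j *\<^sub>R x j) summable_on UNIV"
    using summable_on_Sigma_banach[OF f'] by (simp add: eq)
  have "((A \<star> B) \<triangleright> x) i = (\<Sum>\<^sub>\<infinity>j. \<Sum>\<^sub>\<infinity>k. f (k, j))"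
    by (simp add: mat_vec_def eq)
  also have "\<dots> = (\<Sum>\<^sub>\<infinity>k. \<Sum>\<^sub>\<infinity>j. f (k, j))"
    by (rule infsum_swap_banach) (use f' in simp)
  also have "\<dots> = (A \<triangleright> (B \<triangleright> x)) i"
    unfolding mat_vec_def f_def
    by (simp add: infsum_scaleR_right flip: scaleR_scaleR)
  finally show "((A \<star> B) \<triangleright> x) i = (A \<triangleright> (B \<triangleright> x)) i" .
qed

lemma mat_mult_vec:
  fixes x :: "nat \<Rightarrow> 'a::banach"
  assumes "A \<in> Linf" "B \<in> Linf" "x \<in> ell_inf"
  shows "(A \<star> B) \<triangleright> x = A \<triangleright> (B \<triangleright> x)"
  using mat_mult_vec_aux(2)[OF assms] by blast

lemma Linf_mult:
  assumes "A \<in> Linf" "B \<in> Linf"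
  shows "A \<star> B \<in> Linf"
  unfolding Linf_def
proof (intro CollectI exI[of _ "mnorm A * mnorm B"] ballI conjI allI)
  fix x :: "nat \<Rightarrow> complex" and i assume x: "x \<in> ell_inf"
  show "(\<lambda>j. (A \<star> B) i j *\<^sub>R x j) summable_on UNIV"
    by (rule mat_mult_vec_aux(1)[OF assms x])
  show "(A \<star> B) \<triangleright> x \<in> ell_inf"
    unfolding mat_mult_vec[OF assms x] by (intro mat_vec_ell_inf assms x)
  show "vnorm ((A \<star> B) \<triangleright> x) \<le> mnorm A * mnorm B * vnorm x"
    unfolding mat_mult_vec[OF assms x] mult.assoc
    by (meson assms x order_trans mat_vec_ell_inf vnorm_mat_vec_le mult_left_mono mnorm_nonneg)
qed

lemma mat_mult_assoc:
  assumes "A \<in> Linf" "B \<in> Linf" "C \<in> Linf"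
  shows "(A \<star> B) \<star> C = A \<star> (B \<star> C)"
  by (intro ext) (simp add: mat_mult_conv_mat_vec mat_mult_vec[OF assms(1,2) column_ell_inf[OF assms(3)]])

lemma mat_mult_id_left: "mat_id \<star> A = A"
  by (intro ext) (simp add: mat_mult_conv_mat_vec mat_vec_id)

lemma mat_mult_id_right: "A \<star> mat_id = A"
proof (intro ext)
  fix i j
  have "(A \<star> mat_id) i j = (\<Sum>\<^sub>\<infinity>k\<in>{j}. A i k * mat_id k j)"
    unfolding mat_mult_def by (rule infsum_cong_neutral) (auto simp: mat_id_def)
  then show "(A \<star> mat_id) i j = A i j" by (simp add: mat_id_def)
qed

lemma mat_mult_add_right:
  assumes "A \<in> Linf" "B \<in> Linf" "C \<in> Linf"
  shows "A \<star> (B + C) = A \<star> B + A \<star> C"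
  using mat_vec_add_right[OF assms(1) column_ell_inf[OF assms(2)] column_ell_inf[OF assms(3)]]
  by (intro ext) (simp add: mat_mult_conv_mat_vec plus_fun_def)

lemma mat_mult_add_left:
  assumes "A \<in> Linf" "B \<in> Linf" "C \<in> Linf"
  shows "(A + B) \<star> C = A \<star> C + B \<star> C"
  using mat_vec_add_left[OF assms(1,2) column_ell_inf[OF assms(3)]]
  by (intro ext) (simp add: mat_mult_conv_mat_vec)

lemma mat_mult_diff_right:
  assumes "A \<in> Linf" "B \<in> Linf" "C \<in> Linf"
  shows "A \<star> (B - C) = A \<star> B - A \<star> C"
  using mat_mult_add_right[OF assms(1) Linf_diff[OF assms(2,3)] assms(3)] by simp

lemma mat_mult_diff_left:
  assumes "A \<in> Linf" "B \<in> Linf" "C \<in> Linf"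
  shows "(A - B) \<star> C = A \<star> C - B \<star> C"
  using mat_mult_add_left[OF Linf_diff[OF assms(1,2)] assms(2,3)] by simp

text \<open>Gives access to units and uniqueness of inverses, so that exhibiting a two-sided inverse
  in \<open>Linf\<close> determines \<open>inv\<close>.\<close>

interpretation Linf_monoid: monoid Linf_monoid
  by (rule monoidI) (auto simp: Linf_monoid_def Linf_mult Linf_id mat_mult_assoc
      mat_mult_id_left mat_mult_id_right)

lemma Linf_monoid_simps [simp]:
  "carrier Linf_monoid = Linf" "mult Linf_monoid = (\<star>)" "one Linf_monoid = mat_id"
  by (simp_all add: Linf_monoid_def)

section \<open>Nonnegative matrices\<close>

abbreviation (input) rones :: "nat \<Rightarrow> real" where "rones \<equiv> ones"

lemma ones_nonneg: "0 \<le> rones"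
  by (simp add: le_fun_def ones_def)

lemma mat_vec_nonneg:
  fixes x :: "nat \<Rightarrow> real"
  assumes "0 \<le> A" "0 \<le> x"
  shows "0 \<le> A \<triangleright> x"
  using assms unfolding le_fun_def mat_vec_def by (auto intro!: infsum_nonneg)

lemma mat_mult_nonneg: "0 \<le> A \<Longrightarrow> 0 \<le> B \<Longrightarrow> 0 \<le> A \<star> B"
  unfolding le_fun_def mat_mult_def by (auto intro!: infsum_nonneg)

lemma mat_vec_mono_right:
  fixes x y :: "nat \<Rightarrow> real"
  assumes "A \<in> Linf" "0 \<le> A" "x \<in> ell_inf" "y \<in> ell_inf" "x \<le> y"
  shows "A \<triangleright> x \<le> A \<triangleright> y"
  unfolding mat_vec_def using assms
  by (intro le_funI infsum_mono mat_vec_summable) (auto simp: le_fun_def mult_left_mono)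

lemma mat_vec_mono_left:
  fixes x :: "nat \<Rightarrow> real"
  assumes "A \<in> Linf" "B \<in> Linf" "A \<le> B" "x \<in> ell_inf" "0 \<le> x"
  shows "A \<triangleright> x \<le> B \<triangleright> x"
  unfolding mat_vec_def using assms
  by (intro le_funI infsum_mono mat_vec_summable) (auto simp: le_fun_def mult_right_mono)

lemma mat_mult_mono:
  assumes "A \<in> Linf" "A' \<in> Linf" "B \<in> Linf" "B' \<in> Linf"
    and "A \<le> A'" "B \<le> B'" "0 \<le> A'" "0 \<le> B"
  shows "A \<star> B \<le> A' \<star> B'"
proof (intro le_funI)
  fix i j
  have "(A \<triangleright> (\<lambda>k. B k j)) i \<le> (A' \<triangleright> (\<lambda>k. B k j)) i"
    using mat_vec_mono_left[of A A' "\<lambda>k. B k j"] assms column_ell_inf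
    by (simp add: le_fun_def)
  also have "\<dots> \<le> (A' \<triangleright> (\<lambda>k. B' k j)) i"
    using mat_vec_mono_right[of A' "\<lambda>k. B k j" "\<lambda>k. B' k j"] assms column_ell_inf
    by (simp add: le_fun_def)
  finally show "(A \<star> B) i j \<le> (A' \<star> B') i j" by (simp add: mat_mult_conv_mat_vec)
qed

text \<open>For nonnegative matrices all norm estimates thereby become estimates of the image of the
  vector 1.\<close>

lemma abs_row_sum_nonneg:
  assumes "0 \<le> A"
  shows "(\<Sum>\<^sub>\<infinity>j. \<bar>A i j\<bar>) = (A \<triangleright> rones) i"
  using assms by (simp add: mat_vec_def ones_def le_fun_def)

lemma Linf_nonnegI:
  assumes "0 \<le> A" "\<And>i. (\<lambda>j. A i j) summable_on UNIV" "\<And>i. (A \<triangleright> rones) i \<le> C"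
  shows "A \<in> Linf"
  by (rule LinfI[where C = C])
    (use assms abs_row_sum_nonneg[OF assms(1)] in \<open>auto simp: le_fun_def\<close>)

text \<open>Domination is how a solution of the matrix equation, which need not be bounded by
  definition, is shown to lie in \<open>Linf\<close>.\<close>

lemma Linf_nonneg_mono:
  assumes "0 \<le> A" "A \<le> B" "B \<in> Linf"
  shows "A \<in> Linf"
proof -
  obtain C where C: "\<And>i. (\<Sum>\<^sub>\<infinity>j. \<bar>B i j\<bar>) \<le> C" using Linf_row_bound assms(3) by metis
  have B: "(\<lambda>j. \<bar>B i j\<bar>) summable_on UNIV" for i
    using Linf_row_abs_summable[OF assms(3)] by simp
  have le: "\<bar>A i j\<bar> \<le> \<bar>B i j\<bar>" for i j
    using assms(1,2) by (simp add: le_fun_def) (metis abs_ge_self order_trans)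
  have A: "(\<lambda>j. A i j) abs_summable_on UNIV" for i
    by (rule Infinite_Sum.abs_summable_on_comparison_test'[OF B[of i]]) (use le in simp)
  show ?thesis
  proof (rule LinfI[OF A])
    fix i
    have "(\<Sum>\<^sub>\<infinity>j. \<bar>A i j\<bar>) \<le> (\<Sum>\<^sub>\<infinity>j. \<bar>B i j\<bar>)"
      using A[of i] B le by (intro infsum_mono) auto
    then show "(\<Sum>\<^sub>\<infinity>j. \<bar>A i j\<bar>) \<le> C" using C[of i] by linarith
  qed
qed

lemma entry_le_row_sum:
  assumes "A \<in> Linf" "0 \<le> A"
  shows "A i j \<le> (A \<triangleright> rones) i"
proof -
  have "sum (\<lambda>j. \<bar>A i j\<bar>) {j} \<le> (\<Sum>\<^sub>\<infinity>j. \<bar>A i j\<bar>)"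
    using Linf_row_abs_summable[OF assms(1), of i] by (intro finite_sum_le_infsum) auto
  then show ?thesis by (simp add: abs_row_sum_nonneg[OF assms(2)])
qed

lemma mat_vec_const: "A \<triangleright> (\<lambda>_. c) = (\<lambda>i. c * (A \<triangleright> rones) i)"
  using mat_vec_cmult[of A c rones] by (simp add: ones_def)

lemma const_ell_inf: "(\<lambda>_. c) \<in> ell_inf"
  by (rule ell_infI[of _ "norm c"]) simp

lemma mat_vec_le_const:
  fixes x :: "nat \<Rightarrow> real"
  assumes "A \<in> Linf" "0 \<le> A" "x \<in> ell_inf" "\<And>j. x j \<le> c"
  shows "(A \<triangleright> x) i \<le> c * (A \<triangleright> rones) i"
  using mat_vec_mono_right[OF assms(1-3) const_ell_inf[of c]] assms(4)
  by (simp add: le_fun_def mat_vec_const)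

text \<open>The sign of c matters: row sums may be less than 1, and the step from c times a row sum
  to c uses c \<ge> 0.\<close>

lemma mat_vec_substochastic_le:
  fixes x :: "nat \<Rightarrow> real"
  assumes "A \<in> Linf" "0 \<le> A" "A \<triangleright> rones \<le> ones" "x \<in> ell_inf" "\<And>j. x j \<le> c" "0 \<le> c"
  shows "(A \<triangleright> x) i \<le> c"
proof -
  have "(A \<triangleright> x) i \<le> c * (A \<triangleright> rones) i" by (rule mat_vec_le_const[OF assms(1,2,4,5)])
  also have "\<dots> \<le> c * 1"
    using assms(3,6) by (intro mult_left_mono) (auto simp: le_fun_def ones_def)
  finally show ?thesis by simp
qed

lemma mnorm_le_one:
  assumes "0 \<le> A" "A \<triangleright> rones \<le> ones"
  shows "mnorm A \<le> 1"
  unfolding mnorm_def abs_row_sum_nonneg[OF assms(1)]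
  using assms(2) by (intro cSUP_least) (auto simp: le_fun_def ones_def)

section \<open>Monotone limits and dominated convergence for matrices\<close>

text \<open>Each entry is at most its row sum, hence at most C, so the entries converge as bounded
  increasing sequences.\<close>

lemma incseq_matrix_limit:
  assumes L: "\<And>n. S n \<in> Linf" and nn: "\<And>n. 0 \<le> S n" and inc: "incseq S"
    and bd: "\<And>n i. (S n \<triangleright> rones) i \<le> C"
  obtains T where "T \<in> Linf" "0 \<le> T" "\<And>n. S n \<le> T" "\<And>i j. (\<lambda>n. S n i j) \<longlonglongrightarrow> T i j"
    "\<And>i. (T \<triangleright> rones) i \<le> C"
proof -
  have "\<exists>l. (\<lambda>n. S n i j) \<longlonglongrightarrow> l \<and> (\<forall>n. S n i j \<le> l)" for i j
  proof -
    have "incseq (\<lambda>n. S n i j)" using inc by (simp add: incseq_def le_fun_def)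
    moreover have "S n i j \<le> C" for n
      using entry_le_row_sum[OF L nn, of n i j] bd[of n i] by linarith
    ultimately show ?thesis by (metis incseq_convergent)
  qed
  then obtain T where lim: "\<And>i j. (\<lambda>n. S n i j) \<longlonglongrightarrow> T i j" and ST: "\<And>n i j. S n i j \<le> T i j"
    by metis
  have T0: "0 \<le> T i j" for i j using ST[of 0 i j] nn[of 0] by (simp add: le_fun_def) (meson order_trans)
  \<comment> \<open>Only finite partial row sums are passed to the limit. The resulting bound gives
    both summability of the rows of \<open>T\<close> and their bound C.\<close>
  have fin: "(\<Sum>j\<in>F. T i j) \<le> C" if "finite F" for F i
  proof (rule LIMSEQ_le_const2)
    show "(\<lambda>n. \<Sum>j\<in>F. S n i j) \<longlonglongrightarrow> (\<Sum>j\<in>F. T i j)" by (intro tendsto_sum lim)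
    have "(\<Sum>j\<in>F. S n i j) \<le> C" for n
    proof -
      have "(\<Sum>j\<in>F. \<bar>S n i j\<bar>) \<le> (\<Sum>\<^sub>\<infinity>j. \<bar>S n i j\<bar>)"
        using that Linf_row_abs_summable[OF L, of n i] by (intro finite_sum_le_infsum) auto
      moreover have "\<bar>S n i j\<bar> = S n i j" for j using nn[of n] by (simp add: le_fun_def)
      ultimately show ?thesis using bd[of n i] abs_row_sum_nonneg[OF nn, of n i] by simp
    qed
    then show "\<exists>N. \<forall>n\<ge>N. (\<Sum>j\<in>F. S n i j) \<le> C" by blast
  qed
  have sum: "(\<lambda>j. T i j) summable_on UNIV" for i
    by (rule nonneg_bdd_above_summable_on) (use T0 fin in \<open>auto simp: bdd_above_def intro!: exI[of _ C]\<close>)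
  have row: "(T \<triangleright> rones) i \<le> C" for i
    unfolding mat_vec_def ones_def
    using infsum_le_finite_sums[OF sum[of i]] fin by simp
  have nnT: "0 \<le> T" using T0 by (simp add: le_fun_def)
  show ?thesis
    by (rule that[OF Linf_nonnegI[OF nnT sum row] nnT _ lim row]) (simp add: le_fun_def ST)
qed

text \<open>Dominated convergence in the form of Tannery's theorem: the terms of each approximating
  product entry are dominated by those of \<open>U \<star> V\<close>, whose series
  converges.\<close>

lemma mat_mult_tendsto:
  assumes "U \<in> Linf" "V \<in> Linf"
    and Un: "\<And>n. 0 \<le> Us n" "\<And>n. Us n \<le> U" and Vn: "\<And>n. 0 \<le> Vs n" "\<And>n. Vs n \<le> V"
    and lim: "\<And>i j. (\<lambda>n. Us n i j) \<longlonglongrightarrow> U i j" "\<And>i j. (\<lambda>n. Vs n i j) \<longlonglongrightarrow> V i j"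
  shows "(\<lambda>n. (Us n \<star> Vs n) i j) \<longlonglongrightarrow> (U \<star> V) i j"
proof -
  have U0: "0 \<le> U" and V0: "0 \<le> V" using Un[of 0] Vn[of 0] by auto
  \<comment> \<open>Tannery's theorem speaks of ordinary series, so the unordered sums are
    converted; domination by \<open>U\<close> and \<open>V\<close> supplies the summability.\<close>
  have suminf: "(W \<star> Z) i j = (\<Sum>k. W i k * Z k j)"
    if "0 \<le> W" "W \<le> U" "0 \<le> Z" "Z \<le> V" for W Z
  proof -
    have "(\<lambda>k. W i k * Z k j) summable_on UNIV"
      using mat_vec_summable[OF Linf_nonneg_mono[OF that(1,2) assms(1)]
          column_ell_inf[OF Linf_nonneg_mono[OF that(3,4) assms(2)]]]
      by simp
    then show ?thesis
      unfolding mat_mult_def by (intro sums_unique has_sum_imp_sums) simp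
  qed
  have sum: "summable (\<lambda>k. U i k * V k j)"
    using mat_vec_summable[OF assms(1) column_ell_inf[OF assms(2)], of i j]
    by (intro summable_on_imp_summable) simp
  have "(\<lambda>n. \<Sum>k. Us n i k * Vs n k j) \<longlonglongrightarrow> (\<Sum>k. U i k * V k j)"
  proof (rule tannerys_theorem[THEN conjunct2, THEN conjunct2])
    show "(\<lambda>n. Us n i k * Vs n k j) \<longlonglongrightarrow> U i k * V k j" for k
      by (intro tendsto_mult lim)
    have "norm (Us n i k * Vs n k j) \<le> U i k * V k j" for k n
      using Un[of n] Vn[of n] U0 by (auto simp: le_fun_def abs_mult intro!: mult_mono)
    then show "\<forall>\<^sub>F (k, n) in at_top \<times>\<^sub>F at_top. norm (Us n i k * Vs n k j) \<le> U i k * V k j"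
      by (intro always_eventually) auto
  qed (use sum in auto)
  then show ?thesis
    by (simp add: suminf Un Vn U0 V0)
qed

section \<open>The Neumann series of a nonnegative matrix\<close>

text \<open>For B in \<open>Linf\<close> this is I + B + ... + B^(n-1), with n terms, in Horner
  form; the bound, the monotonicity and the limit equation all follow the recursion.\<close>

definition neumann_sum :: "smat \<Rightarrow> nat \<Rightarrow> smat" where
  "neumann_sum B n = ((\<lambda>S. mat_id + B \<star> S) ^^ n) 0"

lemma neumann_sum_0 [simp]: "neumann_sum B 0 = 0"
  by (simp add: neumann_sum_def)

lemma neumann_sum_Suc: "neumann_sum B (Suc n) = mat_id + B \<star> neumann_sum B n"
  by (simp add: neumann_sum_def)

lemma Linf_zero: "0 \<in> Linf"
  using Linf_diff[OF Linf_id Linf_id] by simp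

lemma mat_mult_zero [simp]: "A \<star> 0 = 0" "0 \<star> A = 0"
  by (auto simp: mat_mult_def fun_eq_iff)

lemma mat_vec_zero_left [simp]: "0 \<triangleright> x = 0"
  by (auto simp: mat_vec_def fun_eq_iff)

lemma neumann_sum_Linf: "B \<in> Linf \<Longrightarrow> neumann_sum B n \<in> Linf"
  by (induction n) (auto simp: neumann_sum_Suc intro: Linf_zero Linf_add Linf_id Linf_mult)

lemma mat_id_nonneg: "0 \<le> mat_id"
  by (simp add: le_fun_def mat_id_def)

lemma neumann_sum_nonneg: "0 \<le> B \<Longrightarrow> 0 \<le> neumann_sum B n"
  by (induction n) (auto simp: neumann_sum_Suc intro!: add_nonneg_nonneg mat_id_nonneg mat_mult_nonneg)

text \<open>Multiplication is not commutative: the defining recursion yields a right inverse of I -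
  B in the limit, and this mirrored one a left inverse.\<close>

lemma neumann_sum_Suc_right:
  assumes "B \<in> Linf"
  shows "neumann_sum B (Suc n) = mat_id + neumann_sum B n \<star> B"
proof (induction n)
  case 0
  have "mat_id + B \<star> neumann_sum B 0 = mat_id + neumann_sum B 0 \<star> B" by simp
  then show ?case by (simp only: neumann_sum_Suc)
next
  case (Suc n)
  note L = neumann_sum_Linf[OF assms]
  have "neumann_sum B (Suc (Suc n)) = mat_id + B \<star> (mat_id + neumann_sum B n \<star> B)"
    by (simp only: neumann_sum_Suc[of B "Suc n"] Suc)
  also have "\<dots> = mat_id + (mat_id + B \<star> neumann_sum B n) \<star> B"
    by (simp add: assms L Linf_id Linf_mult mat_mult_add_left mat_mult_add_right mat_mult_assoc
        mat_mult_id_left mat_mult_id_right)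
  finally show ?case by (simp only: neumann_sum_Suc)
qed

text \<open>The partial sums are nonnegative and increasing with row sums at most 1/(1-\<theta>), so
  they have a limit N in \<open>Linf\<close>. Passing to the limit in both recursions gives N = I +
  B N = I + N B, hence N is the inverse of I - B.\<close>

lemma neumann_inverse:
  assumes B: "B \<in> Linf" "0 \<le> B" and row: "\<And>i. (B \<triangleright> rones) i \<le> \<theta>" and \<theta>: "\<theta> < 1"
  shows "mat_id - B \<in> Units Linf_monoid" and "0 \<le> inv\<^bsub>Linf_monoid\<^esub> (mat_id - B)"
proof -
  note L = neumann_sum_Linf[OF B(1)] and nn = neumann_sum_nonneg[OF B(2)]
  have \<theta>0: "0 \<le> \<theta>"
    using row[of 0] mat_vec_nonneg[OF B(2), of ones] by (simp add: le_fun_def ones_def) (meson order_trans)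
  \<comment> \<open>1/(1-\<theta>) is the fixed point of c \<mapsto> 1 + \<theta> c, so the
    recursion preserves this bound.\<close>
  have bd: "(neumann_sum B n \<triangleright> rones) i \<le> 1 / (1 - \<theta>)" for n i
  proof (induction n arbitrary: i)
    case (Suc n)
    have "(B \<triangleright> (neumann_sum B n \<triangleright> rones)) i \<le> 1 / (1 - \<theta>) * (B \<triangleright> rones) i"
      by (rule mat_vec_le_const[OF B mat_vec_ell_inf[OF L ones_ell_inf] Suc])
    also have "\<dots> \<le> 1 / (1 - \<theta>) * \<theta>" using row \<theta> by (intro mult_left_mono) auto
    finally have "(B \<triangleright> (neumann_sum B n \<triangleright> rones)) i + 1 \<le> \<theta> / (1 - \<theta>) + 1" by simp
    also have "\<dots> = 1 / (1 - \<theta>)" using \<theta> by (simp add: field_simps)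
    finally have "rones i + (B \<triangleright> (neumann_sum B n \<triangleright> rones)) i \<le> 1 / (1 - \<theta>)"
      by (simp add: ones_def)
    then have "(neumann_sum B (Suc n) \<triangleright> rones) i \<le> 1 / (1 - \<theta>)"
      by (simp add: neumann_sum_Suc mat_vec_add_left mat_mult_vec Linf_id Linf_mult B L ones_ell_inf mat_vec_id)
    then show ?case .
  qed (use \<theta> in simp)
  have step: "neumann_sum B n \<le> neumann_sum B (Suc n)" for n
  proof (induction n)
    case 0
    show ?case using nn[of "Suc 0"] by (simp only: neumann_sum_0)
  next
    case (Suc n)
    show ?case
      unfolding neumann_sum_Suc[of B "Suc n"]
      by (subst neumann_sum_Suc) (intro add_left_mono mat_mult_mono B L nn Suc order_refl)
  qed
  obtain N where N: "N \<in> Linf" "0 \<le> N" and le: "\<And>n. neumann_sum B n \<le> N"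
    and lim: "\<And>i j. (\<lambda>n. neumann_sum B n i j) \<longlonglongrightarrow> N i j"
    by (rule incseq_matrix_limit[OF L nn incseq_SucI[of "neumann_sum B", OF step] bd]) blast
  have limS: "(\<lambda>n. neumann_sum B (Suc n) i j) \<longlonglongrightarrow> N i j" for i j
    using lim by (rule LIMSEQ_Suc)
  have "N = mat_id + B \<star> N"
  proof (intro ext)
    fix i j
    have "(\<lambda>n. mat_id i j + (B \<star> neumann_sum B n) i j) \<longlonglongrightarrow> mat_id i j + (B \<star> N) i j"
      by (intro tendsto_intros mat_mult_tendsto B N nn le lim) auto
    then show "N i j = (mat_id + B \<star> N) i j"
      using LIMSEQ_unique[OF limS[of i j]] by (simp add: neumann_sum_Suc)
  qed
  moreover have "N = mat_id + N \<star> B"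
  proof (intro ext)
    fix i j
    have "(\<lambda>n. mat_id i j + (neumann_sum B n \<star> B) i j) \<longlonglongrightarrow> mat_id i j + (N \<star> B) i j"
      by (intro tendsto_intros mat_mult_tendsto B N nn le lim) auto
    then show "N i j = (mat_id + N \<star> B) i j"
      using LIMSEQ_unique[OF limS[of i j]] by (simp add: neumann_sum_Suc_right[OF B(1)])
  qed
  ultimately have r: "(mat_id - B) \<star> N = mat_id" and l: "N \<star> (mat_id - B) = mat_id"
    by (simp_all add: mat_mult_diff_left mat_mult_diff_right Linf_id B N mat_mult_id_left
        mat_mult_id_right diff_eq_eq)
  have I: "mat_id - B \<in> Linf" by (intro Linf_diff Linf_id B)
  show "mat_id - B \<in> Units Linf_monoid"
    unfolding Units_def using I N r l by auto
  show "0 \<le> inv\<^bsub>Linf_monoid\<^esub> (mat_id - B)"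
    using Linf_monoid.inv_unique'[of "mat_id - B" N] I N r l by simp
qed

section \<open>Quasi-birth-death matrices\<close>

definition stochastic :: "smat \<Rightarrow> bool" where
  "stochastic X \<longleftrightarrow> 0 \<le> X \<and> X \<triangleright> rones = ones"

text \<open>A divergent row sum has the default value 0, so rows summing to 1 are summable.\<close>
lemma stochastic_Linf:
  assumes "stochastic X"
  shows "X \<in> Linf"
proof (rule Linf_nonnegI[where C = 1])
  fix i
  have row: "(X \<triangleright> rones) i = 1" using assms by (simp add: stochastic_def ones_def)
  then have "(\<Sum>\<^sub>\<infinity>j. X i j) \<noteq> 0" by (simp add: mat_vec_def ones_def)
  then show "(\<lambda>j. X i j) summable_on UNIV" using infsum_not_exists by blast
  show "(X \<triangleright> rones) i \<le> 1" using row by simp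
qed (use assms in \<open>simp add: stochastic_def\<close>)

lemmas closed_intros = Linf_add Linf_diff Linf_mult Linf_id ones_ell_inf mat_vec_ell_inf
  ell_inf_add ell_inf_diff

lemma vnorm_stochastic_vec_le:
  fixes v :: "nat \<Rightarrow> 'a::banach"
  assumes "stochastic X" "v \<in> ell_inf"
  shows "vnorm (X \<triangleright> v) \<le> vnorm v"
proof -
  have "mnorm X \<le> 1" using assms(1) by (intro mnorm_le_one) (auto simp: stochastic_def)
  then show ?thesis
    using vnorm_mat_vec_le[OF stochastic_Linf[OF assms(1)] assms(2)]
      mult_right_mono[of "mnorm X" 1 "vnorm v"] vnorm_nonneg[OF assms(2)] by simp
qed

text \<open>The split puts Y rightmost in the first term, so that for Y = G it acts directly on an
  eigenvector, and puts the stochastic X leftmost in the second.\<close>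

lemma mat_square_diff:
  assumes "Y \<in> Linf" "X \<in> Linf"
  shows "Y \<star> Y - X \<star> X = (Y - X) \<star> Y + X \<star> (Y - X)"
  using assms by (simp add: mat_mult_diff_left mat_mult_diff_right Linf_mult)

text \<open>The tridiagonal shape is abstracted to nonnegativity and row sums. Given
  \<open>row_sum\<close>, the bound \<open>drift\<close> says that A_{-1} 1 exceeds A_1 1 by at
  least 1 - \<theta> in every row.\<close>

locale qbd =
  fixes A :: "int \<Rightarrow> smat" and \<theta> :: real
  assumes A_Linf: "i \<in> {-1, 0, 1} \<Longrightarrow> A i \<in> Linf"
    and A_nonneg: "i \<in> {-1, 0, 1} \<Longrightarrow> 0 \<le> A i"
    and row_sum: "(A (-1) \<triangleright> rones) r + (A 0 \<triangleright> rones) r + (A 1 \<triangleright> rones) r = 1"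
    and drift: "(A 0 \<triangleright> rones) r + 2 * (A 1 \<triangleright> rones) r \<le> \<theta>"
    and \<theta>_less_1: "\<theta> < 1"
begin

lemma Linf_As [simp]: "A (-1) \<in> Linf" "A 0 \<in> Linf" "A 1 \<in> Linf"
  using A_Linf by simp_all

lemma nonneg_As [simp]: "0 \<le> A (-1)" "0 \<le> A 0" "0 \<le> A 1"
  using A_nonneg by simp_all

lemma row_sum_nonneg: "i \<in> {-1, 0, 1} \<Longrightarrow> 0 \<le> (A i \<triangleright> rones) r"
  using mat_vec_nonneg[OF A_nonneg, of i ones] by (simp add: le_fun_def ones_def)

section \<open>The functional iteration from 0 and the stochasticity of G\<close>

lemma F1_Linf: "X \<in> Linf \<Longrightarrow> F1 A X \<in> Linf"
  unfolding F1_def by (intro closed_intros) simp_all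

lemma F1_nonneg: "0 \<le> X \<Longrightarrow> 0 \<le> F1 A X"
  unfolding F1_def by (intro add_nonneg_nonneg mat_mult_nonneg) simp_all

lemma F1_mono:
  assumes "X \<in> Linf" "Y \<in> Linf" "0 \<le> X" "X \<le> Y"
  shows "F1 A X \<le> F1 A Y"
  unfolding F1_def using assms
  by (intro add_mono mat_mult_mono closed_intros mat_mult_nonneg order_refl) auto

lemma F1_vec:
  fixes x :: "nat \<Rightarrow> 'a::banach"
  assumes "X \<in> Linf" "x \<in> ell_inf"
  shows "F1 A X \<triangleright> x = A (-1) \<triangleright> x + A 0 \<triangleright> (X \<triangleright> x) + A 1 \<triangleright> (X \<triangleright> (X \<triangleright> x))"
  unfolding F1_def using assms by (simp add: mat_vec_add_left mat_mult_vec closed_intros)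

lemma F1_substochastic:
  assumes X: "X \<in> Linf" "0 \<le> X" and row: "X \<triangleright> rones \<le> ones"
  shows "F1 A X \<triangleright> rones \<le> ones"
proof (rule le_funI)
  fix i
  have 1: "(X \<triangleright> rones) j \<le> 1" for j using row by (simp add: le_fun_def ones_def)
  have 2: "(X \<triangleright> (X \<triangleright> rones)) j \<le> 1" for j
    by (rule mat_vec_substochastic_le[OF X row _ 1]) (intro closed_intros X, simp)
  have "(A 0 \<triangleright> (X \<triangleright> rones)) i \<le> 1 * (A 0 \<triangleright> rones) i"
    by (rule mat_vec_le_const[OF _ _ _ 1]) (auto intro!: closed_intros X)
  moreover have "(A 1 \<triangleright> (X \<triangleright> (X \<triangleright> rones))) i \<le> 1 * (A 1 \<triangleright> rones) i"
    by (rule mat_vec_le_const[OF _ _ _ 2]) (auto intro!: closed_intros X)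
  ultimately show "(F1 A X \<triangleright> rones) i \<le> ones i"
    using row_sum[of i] by (simp add: F1_vec X ones_ell_inf) (simp add: ones_def)
qed

text \<open>Rows of a matrix in \<open>Linf\<close> are absolutely summable and its columns bounded,
  which supplies the convergence condition for the square.\<close>

lemma nonneg_solution_iff:
  assumes "Y \<in> Linf"
  shows "nonneg_solution A Y \<longleftrightarrow> 0 \<le> Y \<and> F1 A Y = Y"
proof -
  have "(\<lambda>k. Y i k * Y k j) summable_on UNIV" for i j
    using mat_vec_summable[OF assms column_ell_inf[OF assms]] by simp
  then show ?thesis unfolding nonneg_solution_def F1_def by (simp add: add_ac)
qed

text \<open>Minimality bounds G only by other solutions, so one with row sums at most 1 has to be
  built: \<open>F1\<close> is monotone and preserves substochasticity, hence its iterates from 0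
  increase to such a matrix.\<close>

lemma substochastic_solution:
  obtains T where "nonneg_solution A T" "T \<in> Linf" "T \<triangleright> rones \<le> ones"
proof -
  define S where "S n = (F1 A ^^ n) 0" for n
  have S_Suc: "S (Suc n) = F1 A (S n)" for n by (simp add: S_def)
  have S: "S n \<in> Linf \<and> 0 \<le> S n \<and> S n \<triangleright> rones \<le> ones" for n
  proof (induction n)
    case 0
    have "0 \<triangleright> rones \<le> ones" by (simp add: le_fun_def ones_def)
    then show ?case by (simp only: S_def funpow_0 Linf_zero order_refl simp_thms)
  next
    case (Suc n)
    then show ?case unfolding S_Suc by (blast intro: F1_Linf F1_nonneg F1_substochastic)
  qed
  have step: "S n \<le> S (Suc n)" for n
  proof (induction n)
    case 0
    show ?case using S[of "Suc 0"] by (simp only: S_def funpow_0)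
  next
    case (Suc n)
    show ?case unfolding S_Suc[of "Suc n"] by (subst S_Suc) (use S Suc in \<open>blast intro: F1_mono\<close>)
  qed
  have bd: "(S n \<triangleright> rones) i \<le> 1" for n i using S[of n] by (simp add: le_fun_def ones_def)
  obtain T where T: "T \<in> Linf" "0 \<le> T" and le: "\<And>n. S n \<le> T"
    and lim: "\<And>i j. (\<lambda>n. S n i j) \<longlonglongrightarrow> T i j" and row: "\<And>i. (T \<triangleright> rones) i \<le> 1"
    by (rule incseq_matrix_limit[of S 1]) (use S bd incseq_SucI[of S, OF step] in auto)
  note nn = S[THEN conjunct2, THEN conjunct1] and L = S[THEN conjunct1]
  \<comment> \<open>The quadratic term needs dominated convergence twice: first for the squares,
    dominated by \<open>T \<star> T\<close>, then for their product with \<open>A 1\<close>.\<close>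
  have sq: "(\<lambda>n. (S n \<star> S n) i j) \<longlonglongrightarrow> (T \<star> T) i j" for i j
    by (intro mat_mult_tendsto T nn le lim)
  have sq_le: "S n \<star> S n \<le> T \<star> T" for n
    by (intro mat_mult_mono T nn le L)
  have "F1 A T = T"
  proof (intro ext)
    fix i j
    have "(\<lambda>n. A (-1) i j + (A 0 \<star> S n) i j + (A 1 \<star> (S n \<star> S n)) i j) \<longlonglongrightarrow>
        A (-1) i j + (A 0 \<star> T) i j + (A 1 \<star> (T \<star> T)) i j"
      by (intro tendsto_intros mat_mult_tendsto closed_intros T nn le lim sq sq_le mat_mult_nonneg order_refl)
        simp_all
    then have "(\<lambda>n. S (Suc n) i j) \<longlonglongrightarrow> F1 A T i j" by (simp add: S_Suc F1_def)
    then show "F1 A T i j = T i j" using LIMSEQ_unique LIMSEQ_Suc[OF lim] by blast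
  qed
  then show ?thesis
    using that[of T] T row nonneg_solution_iff[OF T(1)] by (simp add: le_fun_def ones_def)
qed

lemma minimal_solution_substochastic:
  assumes "minimal_nonneg_solution A G"
  shows "G \<in> Linf" "G \<triangleright> rones \<le> ones"
proof -
  obtain T where T: "nonneg_solution A T" "T \<in> Linf" "T \<triangleright> rones \<le> ones"
    by (rule substochastic_solution)
  have G: "0 \<le> G" "G \<le> T"
    using assms T(1) by (auto simp: minimal_nonneg_solution_def nonneg_solution_def)
  show "G \<in> Linf" by (rule Linf_nonneg_mono[OF G T(2)])
  then have "G \<triangleright> rones \<le> T \<triangleright> rones"
    by (intro mat_vec_mono_left G T ones_ell_inf ones_nonneg)
  then show "G \<triangleright> rones \<le> ones" using T(3) by (rule order_trans)
qed

lemma solution_stochastic: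
  assumes sol: "nonneg_solution A G" and G: "G \<in> Linf" "G \<triangleright> rones \<le> ones"
  shows "stochastic G"
proof -
  have G0: "0 \<le> G" and fp: "F1 A G = G" using sol nonneg_solution_iff[OF G(1)] by auto
  define u where "u = ones - G \<triangleright> rones"
  have u: "u \<in> ell_inf" unfolding u_def by (intro closed_intros G)
  have u0: "0 \<le> u i" for i using G(2) by (simp add: u_def le_fun_def)
  have um: "u i \<le> vnorm u" for i using norm_le_vnorm[OF u, of i] by simp
  have Gone: "G \<triangleright> rones = ones - u" by (simp add: u_def)
  have Gu: "(G \<triangleright> u) i \<le> vnorm u" for i
    by (rule mat_vec_substochastic_le[OF G(1) G0 G(2) u um vnorm_nonneg[OF u]])
  \<comment> \<open>Apply G to G 1 = 1 - u and use the same identity again.\<close>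
  have GG: "G \<triangleright> (G \<triangleright> rones) = ones - u - G \<triangleright> u"
    unfolding Gone by (simp add: mat_vec_diff_right G u ones_ell_inf Gone)
  have one: "rones r = (A (-1) \<triangleright> rones + A 0 \<triangleright> rones + A 1 \<triangleright> rones) r" for r
    using row_sum[of r] by (simp add: ones_def)
  have "ones - u = A (-1) \<triangleright> rones + A 0 \<triangleright> (ones - u) + A 1 \<triangleright> (ones - u - G \<triangleright> u)"
    using F1_vec[OF G(1) ones_ell_inf[where 'a = real]] unfolding fp GG unfolding Gone .
  also have "\<dots> = A (-1) \<triangleright> rones + A 0 \<triangleright> rones - A 0 \<triangleright> u
      + (A 1 \<triangleright> rones - A 1 \<triangleright> u - A 1 \<triangleright> (G \<triangleright> u))"
    by (simp add: mat_vec_diff_right u closed_intros G)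
  \<comment> \<open>Subtracting 1 = A_{-1} 1 + A_0 1 + A_1 1 leaves only the terms in u.\<close>
  finally have "u r = (A 0 \<triangleright> u) r + (A 1 \<triangleright> u) r + (A 1 \<triangleright> (G \<triangleright> u)) r" for r
    using one[of r] by (drule_tac fun_cong[of _ _ r]) simp
  have le: "u r \<le> \<theta> * vnorm u" for r
  proof -
    have "u r = (A 0 \<triangleright> u) r + (A 1 \<triangleright> u) r + (A 1 \<triangleright> (G \<triangleright> u)) r" by fact
    \<comment> \<open>Both u and G u are at most \<open>vnorm u\<close>, so A_1 is counted twice;
      this is exactly the combination s_0 + 2 s_1 bounded by \<theta>.\<close>
    also have "\<dots> \<le> vnorm u * (A 0 \<triangleright> rones) r + vnorm u * (A 1 \<triangleright> rones) r + vnorm u * (A 1 \<triangleright> rones) r"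
      by (intro add_mono mat_vec_le_const um Gu closed_intros u G) simp_all
    also have "\<dots> = vnorm u * ((A 0 \<triangleright> rones) r + 2 * (A 1 \<triangleright> rones) r)" by (simp add: algebra_simps)
    also have "\<dots> \<le> vnorm u * \<theta>" using drift vnorm_nonneg[OF u] by (intro mult_left_mono)
    finally show ?thesis by (simp add: mult.commute)
  qed
  have "vnorm u \<le> \<theta> * vnorm u" using le u0 by (intro vnorm_le) simp
  then have "(1 - \<theta>) * vnorm u \<le> 0" by (simp add: algebra_simps)
  then have "vnorm u = 0" using \<theta>_less_1 vnorm_nonneg[OF u] by (simp add: mult_le_0_iff)
  then have "u i = 0" for i using um[of i] u0[of i] by simp
  then have "u = 0" by (simp add: fun_eq_iff)
  then show ?thesis using G0 Gone by (simp add: stochastic_def)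
qed

end

section \<open>Inverses, and preservation of stochasticity by F_1, F_2, F_3\<close>

context qbd
begin

lemma stochastic_vec: "stochastic X \<Longrightarrow> X \<triangleright> rones = ones"
  by (simp add: stochastic_def)

lemma F1_stochastic:
  assumes "stochastic X"
  shows "stochastic (F1 A X)"
proof -
  have X: "X \<in> Linf" "0 \<le> X" "X \<triangleright> rones = ones"
    using assms stochastic_Linf by (auto simp: stochastic_def)
  have "(F1 A X \<triangleright> rones) i = ones i" for i
    using row_sum[of i] by (simp add: F1_vec X ones_ell_inf) (simp add: ones_def)
  then show ?thesis unfolding stochastic_def using F1_nonneg[OF X(2)] by blast
qed

text \<open>s_0 \<le> s_0 + 2 s_1 \<le> \<theta>, so the Neumann series applies to A_0.\<close>

lemma unit_A0: "mat_id - A 0 \<in> Units Linf_monoid"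
  and inv_A0_nonneg: "0 \<le> inv\<^bsub>Linf_monoid\<^esub> (mat_id - A 0)"
proof -
  have "(A 0 \<triangleright> rones) r \<le> \<theta>" for r using drift[of r] row_sum_nonneg[of 1 r] by simp
  from neumann_inverse[OF _ _ this \<theta>_less_1]
  show "mat_id - A 0 \<in> Units Linf_monoid" "0 \<le> inv\<^bsub>Linf_monoid\<^esub> (mat_id - A 0)" by simp_all
qed

text \<open>As X 1 = 1, the nonnegative matrix A_0 + A_1 X has row sums s_0 + s_1 \<le> \<theta>,
  and the matrix to be inverted is I minus it.\<close>

lemma unit_A0_A1:
  assumes "stochastic X"
  shows "mat_id - A 0 - A 1 \<star> X \<in> Units Linf_monoid"
    and "0 \<le> inv\<^bsub>Linf_monoid\<^esub> (mat_id - A 0 - A 1 \<star> X)"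
proof -
  have X: "X \<in> Linf" "0 \<le> X" "X \<triangleright> rones = ones"
    using assms stochastic_Linf by (auto simp: stochastic_def)
  have "((A 0 + A 1 \<star> X) \<triangleright> rones) r \<le> \<theta>" for r
    using drift[of r] row_sum_nonneg[of 1 r] by (simp add: mat_vec_add_left mat_mult_vec X closed_intros)
  from neumann_inverse[OF _ _ this \<theta>_less_1]
  show "mat_id - A 0 - A 1 \<star> X \<in> Units Linf_monoid"
    "0 \<le> inv\<^bsub>Linf_monoid\<^esub> (mat_id - A 0 - A 1 \<star> X)"
    by (simp_all add: diff_diff_eq closed_intros X add_nonneg_nonneg mat_mult_nonneg)
qed

end

lemma unit_inverse:
  assumes "M \<in> Units Linf_monoid"
  shows "inv\<^bsub>Linf_monoid\<^esub> M \<in> Linf" "M \<in> Linf"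
    "inv\<^bsub>Linf_monoid\<^esub> M \<star> M = mat_id" "M \<star> inv\<^bsub>Linf_monoid\<^esub> M = mat_id"
  using Linf_monoid.Units_inv_closed[OF assms] Linf_monoid.Units_closed[OF assms]
    Linf_monoid.Units_l_inv[OF assms] Linf_monoid.Units_r_inv[OF assms] by simp_all

text \<open>Brings a linear equation satisfied by G into a form comparable with \<open>F2\<close> or
  \<open>F3\<close>.\<close>

lemma inv_mult_eqI:
  assumes "M \<in> Units Linf_monoid" "X \<in> Linf" "M \<star> X = Y"
  shows "X = inv\<^bsub>Linf_monoid\<^esub> M \<star> Y"
  unfolding assms(3)[symmetric]
  by (simp add: unit_inverse[OF assms(1)] assms(2) mat_mult_id_left flip: mat_mult_assoc)

text \<open>Row sums behind an inverse are found without computing it: it suffices to apply M to the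
  expected vector 1.\<close>

lemma inv_vec_eqI:
  fixes x :: "nat \<Rightarrow> 'a::banach"
  assumes "M \<in> Units Linf_monoid" "x \<in> ell_inf" "M \<triangleright> x = y"
  shows "inv\<^bsub>Linf_monoid\<^esub> M \<triangleright> y = x"
  unfolding assms(3)[symmetric]
  by (simp add: unit_inverse[OF assms(1)] assms(2) mat_vec_id flip: mat_mult_vec)

context qbd
begin

text \<open>With X 1 = 1, both (I - A_0) 1 and (A_{-1} + A_1 X^2) 1 equal s_{-1} + s_1.\<close>

lemma F2_stochastic:
  assumes "stochastic X"
  shows "stochastic (F2 A X)"
proof -
  note X = stochastic_Linf[OF assms] stochastic_vec[OF assms]
  have X0: "0 \<le> X" using assms by (simp add: stochastic_def)
  note N = unit_inverse(1)[OF unit_A0]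
  have "((mat_id - A 0) \<triangleright> rones) r = ((A (-1) + A 1 \<star> (X \<star> X)) \<triangleright> rones) r" for r
    using row_sum[of r]
    by (simp add: mat_vec_diff_left mat_vec_add_left mat_mult_vec X closed_intros mat_vec_id)
      (simp add: ones_def)
  then have "inv\<^bsub>Linf_monoid\<^esub> (mat_id - A 0) \<triangleright> ((A (-1) + A 1 \<star> (X \<star> X)) \<triangleright> rones) = ones"
    by (intro inv_vec_eqI unit_A0 closed_intros ext)
  then have "F2 A X \<triangleright> rones = ones"
    unfolding F2_def by (subst mat_mult_vec) (simp_all add: N X closed_intros)
  moreover have "0 \<le> F2 A X"
    unfolding F2_def by (intro mat_mult_nonneg inv_A0_nonneg add_nonneg_nonneg X0) simp_all
  ultimately show ?thesis by (simp add: stochastic_def)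
qed

text \<open>(I - A_0 - A_1 X) 1 = 1 - s_0 - s_1 = s_{-1}. This gives the row sums of
  \<open>F3\<close> and also the norm bound behind the limsup.\<close>

lemma inv_A0_A1_vec:
  assumes "stochastic X"
  shows "inv\<^bsub>Linf_monoid\<^esub> (mat_id - A 0 - A 1 \<star> X) \<triangleright> (A (-1) \<triangleright> rones) = ones"
proof (intro inv_vec_eqI unit_A0_A1 assms closed_intros ext)
  note X = stochastic_Linf[OF assms] stochastic_vec[OF assms]
  show "((mat_id - A 0 - A 1 \<star> X) \<triangleright> rones) r = (A (-1) \<triangleright> rones) r" for r
    using row_sum[of r]
    by (simp add: mat_vec_diff_left mat_mult_vec X closed_intros mat_vec_id) (simp add: ones_def)
qed

lemma F3_stochastic:
  assumes "stochastic X"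
  shows "stochastic (F3 A X)"
proof -
  note N = unit_inverse(1)[OF unit_A0_A1(1)[OF assms]]
  have "F3 A X \<triangleright> rones = ones"
    unfolding F3_def using inv_A0_A1_vec[OF assms] by (subst mat_mult_vec) (simp_all add: N closed_intros)
  moreover have "0 \<le> F3 A X"
    unfolding F3_def by (intro mat_mult_nonneg unit_A0_A1 assms) simp
  ultimately show ?thesis by (simp add: stochastic_def)
qed

text \<open>Since s_1 \<le> s_{-1} for the row sums s_i of A_i, this follows from \<open>N s_{-1} = 1\<close>.\<close>
lemma inv_A1_mnorm_le:
  assumes X: "stochastic X" and le: "A 1 \<triangleright> rones \<le> A (-1) \<triangleright> rones"
  shows "mnorm (inv\<^bsub>Linf_monoid\<^esub> (mat_id - A 0 - A 1 \<star> X) \<star> A 1) \<le> 1"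
proof (rule mnorm_le_one)
  let ?N = "inv\<^bsub>Linf_monoid\<^esub> (mat_id - A 0 - A 1 \<star> X)"
  note N = unit_inverse(1)[OF unit_A0_A1(1)[OF X]] unit_A0_A1(2)[OF X]
  show "0 \<le> ?N \<star> A 1" by (intro mat_mult_nonneg N) simp
  have "(?N \<star> A 1) \<triangleright> rones = ?N \<triangleright> (A 1 \<triangleright> rones)"
    by (intro mat_mult_vec N closed_intros) simp
  also have "\<dots> \<le> ?N \<triangleright> (A (-1) \<triangleright> rones)"
    by (intro mat_vec_mono_right N le closed_intros) simp_all
  also have "\<dots> = ones" by (rule inv_A0_A1_vec[OF X])
  finally show "(?N \<star> A 1) \<triangleright> rones \<le> ones" .
qed

end

section \<open>Propagation of the error along an eigenvector of G\<close>

locale qbd_eigenvector = qbd +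
  fixes G :: smat and w :: "nat \<Rightarrow> complex" and \<mu> :: complex
  assumes G_stochastic: "stochastic G"
    and G_fixpoint: "F1 A G = G"
    and w: "w \<in> ell_inf"
    and eigen: "G \<triangleright> w = (\<lambda>r. \<mu> * w r)"
begin

lemma G_Linf [simp]: "G \<in> Linf"
  by (rule stochastic_Linf[OF G_stochastic])

lemma error_eigenvector:
  assumes "X \<in> Linf"
  shows "((G - X) \<star> G) \<triangleright> w = (\<lambda>r. \<mu> * ((G - X) \<triangleright> w) r)"
  using assms by (simp add: mat_mult_vec closed_intros w eigen mat_vec_cmult)

text \<open>Source of the factor |\<mu>| + 1 in H_1 and H_2: with v = (G - X) w the vector equals
  \<mu> v + X v, and X has norm at most 1.\<close>

lemma square_error_vec:
  assumes X: "stochastic X"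
  shows "((G \<star> G - X \<star> X) \<triangleright> w) \<in> ell_inf"
    and "vnorm ((G \<star> G - X \<star> X) \<triangleright> w) \<le> (cmod \<mu> + 1) * vnorm ((G - X) \<triangleright> w)"
proof -
  note XL [simp] = stochastic_Linf[OF X]
  define v where "v = (G - X) \<triangleright> w"
  have v: "v \<in> ell_inf" unfolding v_def by (intro closed_intros w) simp_all
  show "((G \<star> G - X \<star> X) \<triangleright> w) \<in> ell_inf" by (intro closed_intros w) simp_all
  have "(G \<star> G - X \<star> X) \<triangleright> w = ((G - X) \<star> G) \<triangleright> w + (X \<star> (G - X)) \<triangleright> w"
    unfolding mat_square_diff[OF G_Linf XL] by (simp add: mat_vec_add_left closed_intros w)
  also have "\<dots> = (\<lambda>r. \<mu> * v r) + X \<triangleright> v"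
    by (simp add: error_eigenvector mat_mult_vec[of X "G - X"] closed_intros w flip: v_def)
  finally have eq: "(G \<star> G - X \<star> X) \<triangleright> w = (\<lambda>r. \<mu> * v r) + X \<triangleright> v" .
  have "norm (((\<lambda>r. \<mu> * v r) + X \<triangleright> v) r) \<le> (cmod \<mu> + 1) * vnorm v" for r
  proof -
    have "norm ((X \<triangleright> v) r) \<le> vnorm v"
      using norm_le_vnorm[OF mat_vec_ell_inf[OF XL v], of r] vnorm_stochastic_vec_le[OF X v] by linarith
    moreover have "norm (\<mu> * v r) \<le> cmod \<mu> * vnorm v"
      by (simp add: norm_mult mult_left_mono norm_le_vnorm[OF v])
    ultimately show ?thesis
      using norm_triangle_ineq[of "\<mu> * v r" "(X \<triangleright> v) r"] by (simp add: algebra_simps)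
  qed
  then show "vnorm ((G \<star> G - X \<star> X) \<triangleright> w) \<le> (cmod \<mu> + 1) * vnorm ((G - X) \<triangleright> w)"
    unfolding eq v_def[symmetric] by (rule vnorm_le)
qed

text \<open>The two terms are estimated row by row before taking the supremum. Bounding them by
  separate matrix norms would give a sum of suprema, which can exceed the norm of H_1.\<close>

lemma F1_error:
  assumes X: "stochastic X"
  shows "vnorm ((G - F1 A X) \<triangleright> w) \<le> mnorm (H1 A \<mu>) * vnorm ((G - X) \<triangleright> w)"
proof -
  note XL [simp] = stochastic_Linf[OF X]
  note z = square_error_vec[OF X]
  define v where "v = (G - X) \<triangleright> w"
  have v: "v \<in> ell_inf" unfolding v_def by (intro closed_intros w) simp_all
  \<comment> \<open>G = F_1(G), so the terms A_{-1} cancel.\<close>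
  have "G - F1 A X = A 0 \<star> (G - X) + A 1 \<star> (G \<star> G - X \<star> X)"
    by (subst G_fixpoint[symmetric]) (simp add: F1_def mat_mult_diff_right Linf_mult)
  then have eq: "(G - F1 A X) \<triangleright> w = A 0 \<triangleright> v + A 1 \<triangleright> ((G \<star> G - X \<star> X) \<triangleright> w)"
    by (simp add: mat_vec_add_left mat_mult_vec[of "A 0"] mat_mult_vec[of "A 1"] closed_intros w v_def)
  have H: "H1 A \<mu> \<in> Linf" "0 \<le> H1 A \<mu>"
    unfolding H1_def
    by (simp add: Linf_add Linf_scale) (use nonneg_As in \<open>simp add: le_fun_def mat_scale_def\<close>)
  have Hrow: "(H1 A \<mu> \<triangleright> rones) r = (cmod \<mu> + 1) * (A 1 \<triangleright> rones) r + (A 0 \<triangleright> rones) r" for r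
    unfolding H1_def by (simp add: mat_vec_add_left Linf_scale ones_ell_inf)
      (simp add: mat_vec_def mat_scale_def infsum_cmult_right' mult.assoc)
  have "norm ((A 0 \<triangleright> v + A 1 \<triangleright> ((G \<star> G - X \<star> X) \<triangleright> w)) r) \<le> mnorm (H1 A \<mu>) * vnorm v" for r
  proof -
    have "norm ((A 0 \<triangleright> v) r) \<le> (A 0 \<triangleright> rones) r * vnorm v"
      using norm_mat_vec_le_row[of "A 0" v r] v by (simp add: abs_row_sum_nonneg)
    moreover have "norm ((A 1 \<triangleright> ((G \<star> G - X \<star> X) \<triangleright> w)) r)
        \<le> (A 1 \<triangleright> rones) r * ((cmod \<mu> + 1) * vnorm v)"
      using norm_mat_vec_le_row[of "A 1" "(G \<star> G - X \<star> X) \<triangleright> w" r] z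
        mult_left_mono[OF z(2), of "(A 1 \<triangleright> rones) r"] row_sum_nonneg[of 1 r]
      by (simp add: abs_row_sum_nonneg flip: v_def)
    ultimately have "norm ((A 0 \<triangleright> v + A 1 \<triangleright> ((G \<star> G - X \<star> X) \<triangleright> w)) r) \<le> (H1 A \<mu> \<triangleright> rones) r * vnorm v"
      unfolding Hrow plus_fun_apply by (intro norm_triangle_le) (simp add: algebra_simps)
    also have "\<dots> \<le> mnorm (H1 A \<mu>) * vnorm v"
      using row_sum_le_mnorm[OF H(1), of r] vnorm_nonneg[OF v]
      by (intro mult_right_mono) (simp_all add: abs_row_sum_nonneg[OF H(2)])
    finally show ?thesis .
  qed
  then show ?thesis unfolding eq v_def[symmetric] by (rule vnorm_le)
qed

lemma F2_error:
  assumes X: "stochastic X"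
  shows "vnorm ((G - F2 A X) \<triangleright> w) \<le> mnorm (H2 A \<mu>) * vnorm ((G - X) \<triangleright> w)"
proof -
  note XL [simp] = stochastic_Linf[OF X]
  note z = square_error_vec[OF X]
  let ?N = "inv\<^bsub>Linf_monoid\<^esub> (mat_id - A 0)"
  let ?z = "(G \<star> G - X \<star> X) \<triangleright> w"
  define v where "v = (G - X) \<triangleright> w"
  have v: "v \<in> ell_inf" unfolding v_def by (intro closed_intros w) simp_all
  note N [simp] = unit_inverse(1)[OF unit_A0]
  \<comment> \<open>The fixed-point equation with A_0 G moved to the left, that is, G =
    F_2(G).\<close>
  have "(mat_id - A 0) \<star> G = A (-1) + A 1 \<star> (G \<star> G)"
    using G_fixpoint by (simp add: F1_def mat_mult_diff_left Linf_id mat_mult_id_left algebra_simps)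
  from inv_mult_eqI[OF unit_A0 G_Linf this]
  have "G - F2 A X = ?N \<star> (A (-1) + A 1 \<star> (G \<star> G)) - ?N \<star> (A (-1) + A 1 \<star> (X \<star> X))"
    by (simp add: F2_def)
  also have "\<dots> = (?N \<star> A 1) \<star> (G \<star> G - X \<star> X)"
    by (simp add: closed_intros mat_mult_assoc mat_mult_diff_right mat_mult_add_right)
  finally have eq: "(G - F2 A X) \<triangleright> w = (?N \<star> A 1) \<triangleright> ?z"
    by (simp add: mat_mult_vec[of "?N \<star> A 1"] closed_intros w)
  have M [simp]: "?N \<star> A 1 \<in> Linf" by (intro closed_intros) simp_all
  have "norm (((?N \<star> A 1) \<triangleright> ?z) r) \<le> mnorm (H2 A \<mu>) * vnorm v" for r
  proof -
    have "norm (((?N \<star> A 1) \<triangleright> ?z) r) \<le> (\<Sum>\<^sub>\<infinity>j. \<bar>(?N \<star> A 1) r j\<bar>) * ((cmod \<mu> + 1) * vnorm v)"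
      using norm_mat_vec_le_row[OF M z(1), of r]
        mult_left_mono[OF z(2), of "\<Sum>\<^sub>\<infinity>j. \<bar>(?N \<star> A 1) r j\<bar>"]
      by (simp add: infsum_nonneg flip: v_def)
    also have "\<dots> = (\<Sum>\<^sub>\<infinity>j. \<bar>H2 A \<mu> r j\<bar>) * vnorm v"
      unfolding H2_def abs_row_sum_scale by simp
    also have "\<dots> \<le> mnorm (H2 A \<mu>) * vnorm v"
      unfolding H2_def
      by (intro mult_right_mono row_sum_le_mnorm Linf_scale M vnorm_nonneg v)
    finally show ?thesis .
  qed
  then show ?thesis unfolding eq v_def[symmetric] by (rule vnorm_le)
qed

text \<open>The error is (I - A_0 - A_1 X)^{-1} A_1 (G - X) G: no term X (G - X) arises, hence the
  factor |\<mu>| in place of |\<mu>| + 1.\<close>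

lemma F3_error:
  assumes X: "stochastic X"
  shows "vnorm ((G - F3 A X) \<triangleright> w)
    \<le> cmod \<mu> * mnorm (inv\<^bsub>Linf_monoid\<^esub> (mat_id - A 0 - A 1 \<star> X) \<star> A 1) * vnorm ((G - X) \<triangleright> w)"
proof -
  note XL [simp] = stochastic_Linf[OF X]
  let ?B = "mat_id - A 0 - A 1 \<star> X"
  let ?N = "inv\<^bsub>Linf_monoid\<^esub> ?B"
  define v where "v = (G - X) \<triangleright> w"
  have v: "v \<in> ell_inf" unfolding v_def by (intro closed_intros w) simp_all
  note N [simp] = unit_inverse(1)[OF unit_A0_A1(1)[OF X]]
  \<comment> \<open>The matrix inverted in F_3(X) is applied to G, so that both G and F_3(X) carry
    the same inverse; the excess of \<open>?B \<star> G\<close> over A_{-1} is A_1 (G - X)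
    G.\<close>
  have "?B \<star> G = G - A 0 \<star> G - A 1 \<star> (X \<star> G)"
    by (simp add: mat_mult_diff_left mat_mult_assoc closed_intros mat_mult_id_left)
  moreover have "A 1 \<star> ((G - X) \<star> G) = A 1 \<star> (G \<star> G) - A 1 \<star> (X \<star> G)"
    by (simp add: mat_mult_diff_left mat_mult_diff_right closed_intros)
  moreover have "G - A 0 \<star> G = A (-1) + A 1 \<star> (G \<star> G)"
    using G_fixpoint by (simp add: F1_def algebra_simps)
  ultimately have "?B \<star> G = A (-1) + A 1 \<star> ((G - X) \<star> G)"
    by (simp only: add_diff_eq)
  from inv_mult_eqI[OF unit_A0_A1(1)[OF X] G_Linf this]
  have "G - F3 A X = ?N \<star> (A (-1) + A 1 \<star> ((G - X) \<star> G)) - ?N \<star> A (-1)"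
    by (simp add: F3_def)
  also have "\<dots> = (?N \<star> A 1) \<star> ((G - X) \<star> G)"
    by (simp add: closed_intros mat_mult_assoc mat_mult_add_right)
  finally have eq: "(G - F3 A X) \<triangleright> w = (?N \<star> A 1) \<triangleright> (\<lambda>r. \<mu> * v r)"
    by (simp add: mat_mult_vec[of "?N \<star> A 1"] closed_intros w error_eigenvector v_def)
  have M: "?N \<star> A 1 \<in> Linf" by (intro closed_intros) simp_all
  have "vnorm ((?N \<star> A 1) \<triangleright> (\<lambda>r. \<mu> * v r)) \<le> mnorm (?N \<star> A 1) * vnorm (\<lambda>r. \<mu> * v r)"
    by (intro vnorm_mat_vec_le M ell_inf_cmult v)
  also have "\<dots> \<le> mnorm (?N \<star> A 1) * (cmod \<mu> * vnorm v)"
    by (intro mult_left_mono vnorm_cmult_le v mnorm_nonneg M)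
  finally show ?thesis unfolding eq v_def[symmetric] by (simp add: mult_ac)
qed

end

section \<open>The block matrices and their uniform drift\<close>

lemma qbd_block_finite_row: "j \<notin> {..Suc r} \<Longrightarrow> qbd_block a b i r j = 0"
  by (auto simp: qbd_block_def)

lemma qbd_block_row_sum:
  "(qbd_block a b i \<triangleright> rones) r =
    (if r = 0 then \<Sum>j\<in>{0..1}. b i j else \<Sum>j\<in>{-1..1}. a i j)"
proof (cases r)
  case 0
  have "(qbd_block a b i \<triangleright> rones) 0 = (\<Sum>j\<in>{0, 1}. qbd_block a b i 0 j *\<^sub>R ones j)"
    by (rule mat_vec_finite_row) (auto simp: qbd_block_def)
  moreover have "{0..1::int} = {0, 1}" by auto
  ultimately show ?thesis using 0 by (simp add: qbd_block_def ones_def)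
next
  case (Suc n)
  have "(qbd_block a b i \<triangleright> rones) (Suc n)
      = (\<Sum>j\<in>{n, Suc n, Suc (Suc n)}. qbd_block a b i (Suc n) j *\<^sub>R ones j)"
    by (rule mat_vec_finite_row) (auto simp: qbd_block_def)
  moreover have "{-1..1::int} = {-1, 0, 1}" by auto
  ultimately show ?thesis using Suc by (simp add: qbd_block_def ones_def)
qed

lemma qbd_block_nonneg:
  assumes "\<forall>j\<in>{-1..1}. 0 \<le> a i j" "\<forall>j\<in>{0..1}. 0 \<le> b i j"
  shows "0 \<le> qbd_block a b i"
proof -
  have "0 \<le> a i (int c - int r)" if "\<bar>int c - int r\<bar> \<le> 1" for c r
    using that by (intro assms(1)[rule_format]) (simp add: abs_le_iff)
  moreover have "0 \<le> b i (int c)" if "c \<le> 1" for c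
    using that by (intro assms(2)[rule_format]) simp
  ultimately show ?thesis by (simp add: le_fun_def qbd_block_def)
qed

lemma qbd_block_Linf:
  assumes "\<forall>j\<in>{-1..1}. 0 \<le> a i j" "\<forall>j\<in>{0..1}. 0 \<le> b i j"
  shows "qbd_block a b i \<in> Linf"
proof (rule Linf_nonnegI)
  show "0 \<le> qbd_block a b i" by (rule qbd_block_nonneg[of a i b]) (use assms in simp_all)
  show "(\<lambda>j. qbd_block a b i r j) summable_on UNIV" for r
    by (rule finite_nonzero_values_imp_summable_on, rule finite_subset[of _ "{..Suc r}"])
      (use qbd_block_finite_row[of _ r a b i] in force, simp)
  show "(qbd_block a b i \<triangleright> rones) r \<le> max (\<Sum>j\<in>{0..1}. b i j) (\<Sum>j\<in>{-1..1}. a i j)" for r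
    by (simp add: qbd_block_row_sum)
qed

lemma qbd_qbd_block:
  assumes a_nonneg: "\<forall>i\<in>{-1..1}. \<forall>j\<in>{-1..1}. 0 \<le> a i j"
    and b_nonneg: "\<forall>i\<in>{-1..1}. \<forall>j\<in>{0..1}. 0 \<le> b i j"
    and a_sum: "(\<Sum>i\<in>{-1..1}. \<Sum>j\<in>{-1..1}. a i j) = 1"
    and b_sum: "(\<Sum>i\<in>{-1..1}. \<Sum>j\<in>{0..1}. b i j) = 1"
    and drift: "\<forall>r. (qbd_block a b 1 \<triangleright> rones) r < (qbd_block a b (-1) \<triangleright> rones) r"
  obtains \<theta> where "qbd (qbd_block a b) \<theta>"
proof -
  define s where "s i r = (qbd_block a b i \<triangleright> rones) r" for i r
  have int3: "{-1..1::int} = {-1, 0, 1}" by auto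
  have sum: "s (-1) r + s 0 r + s 1 r = 1" for r
    using a_sum b_sum by (simp add: s_def qbd_block_row_sum int3 add.assoc)
  have s_Suc: "s i (Suc r) = s i 1" for i r by (simp add: s_def qbd_block_row_sum)
  \<comment> \<open>Row 0 is the boundary row and row 1 stands for all later rows, so two values
    suffice and strictness in each row becomes a uniform gap.\<close>
  define \<theta> where "\<theta> = max (s 0 0 + 2 * s 1 0) (s 0 1 + 2 * s 1 1)"
  \<comment> \<open>s_1 < s_{-1} gives s_0 + 2 s_1 < s_0 + s_1 + s_{-1} = 1.\<close>
  have "s 0 r + 2 * s 1 r < 1" for r
    using sum[of r] drift[rule_format, of r, folded s_def] by linarith
  then have \<theta>: "\<theta> < 1" by (simp add: \<theta>_def)
  have le: "s 0 r + 2 * s 1 r \<le> \<theta>" for r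
  proof (cases r)
    case (Suc n)
    show ?thesis unfolding \<theta>_def Suc s_Suc by (rule max.cobounded2)
  qed (simp add: \<theta>_def)
  have "qbd (qbd_block a b) \<theta>"
  proof
    fix i :: int assume "i \<in> {-1, 0, 1}"
    then have i: "i \<in> {-1..1}" by (simp only: int3)
    show "qbd_block a b i \<in> Linf" "0 \<le> qbd_block a b i"
      using qbd_block_Linf qbd_block_nonneg a_nonneg[rule_format, OF i] b_nonneg[rule_format, OF i]
      by blast+
  qed (rule sum[unfolded s_def] le[unfolded s_def] \<theta>)+
  then show ?thesis by (rule that)
qed

text \<open>The maps are total functions in the logic, so well-definedness is expressed by the
  invertibility of the matrices inverted in F_2 and F_3, together with membership of all iterates in
  \<open>Linf\<close>.\<close>

theorem theorem4p3:
  fixes a b :: "int \<Rightarrow> int \<Rightarrow> real"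
    and A :: "int \<Rightarrow> smat"
    and G :: smat
    and X :: "nat \<Rightarrow> nat \<Rightarrow> smat"
  assumes a_nonneg: "\<forall>i\<in>{-1..1}. \<forall>j\<in>{-1..1}. 0 \<le> a i j"
    and b_nonneg: "\<forall>i\<in>{-1..1}. \<forall>j\<in>{0..1}. 0 \<le> b i j"
    and a_sum: "(\<Sum>i\<in>{-1..1}. \<Sum>j\<in>{-1..1}. a i j) = 1"
    and b_sum: "(\<Sum>i\<in>{-1..1}. \<Sum>j\<in>{0..1}. b i j) = 1"
    and a_two: "\<exists>i\<in>{-1..1}. 2 \<le> card {j\<in>{-1..1}. a i j \<noteq> 0}"
    and A_eq: "A = qbd_block a b"
    and drift: "\<forall>r. (A 1 \<triangleright> (ones :: nat \<Rightarrow> real)) r < (A (-1) \<triangleright> ones) r"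
    and G_min: "minimal_nonneg_solution A G"
    and X_init: "\<forall>i\<in>{1,2,3}. 0 \<le> X i 0 \<and> X i 0 \<triangleright> (ones :: nat \<Rightarrow> real) = ones"
    and X_step1: "\<forall>k. X 1 (Suc k) = F1 A (X 1 k)"
    and X_step2: "\<forall>k. X 2 (Suc k) = F2 A (X 2 k)"
    and X_step3: "\<forall>k. X 3 (Suc k) = F3 A (X 3 k)"
  shows
    "(mat_id - A 0 \<in> Units Linf_monoid \<and>
      (\<forall>k. mat_id - A 0 - A 1 \<star> X 3 k \<in> Units Linf_monoid) \<and>
      (\<forall>i\<in>{1,2,3}. \<forall>k. X i k \<in> Linf)) \<and>
     (\<forall>i\<in>{1,2,3}. \<forall>k. 0 \<le> X i k \<and> X i k \<triangleright> (ones :: nat \<Rightarrow> real) = ones) \<and>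
     (\<forall>i\<in>{1,2,3}. \<forall>k. G - X i k \<in> Linf \<and> (G - X i k) \<triangleright> (ones :: nat \<Rightarrow> real) = 0) \<and>
     (\<forall>(w :: nat \<Rightarrow> complex) \<mu> :: complex.
        w \<in> ell_inf \<and> w \<noteq> 0 \<and> w \<noteq> ones \<and> G \<triangleright> w = (\<lambda>r. \<mu> * w r) \<longrightarrow>
        (let W = (\<lambda>i k. (G - X i k) \<triangleright> w) in
           (\<forall>k. vnorm (W 1 (Suc k)) \<le> mnorm (H1 A \<mu>) * vnorm (W 1 k)) \<and>
           (\<forall>k. vnorm (W 2 (Suc k)) \<le> mnorm (H2 A \<mu>) * vnorm (W 2 k)) \<and>
           (\<forall>k. vnorm (W 3 (Suc k)) \<le>
              cmod \<mu> * mnorm (inv\<^bsub>Linf_monoid\<^esub> (mat_id - A 0 - A 1 \<star> X 3 k) \<star> A 1) * vnorm (W 3 k)) \<and>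
           limsup (\<lambda>k. ereal (vnorm (W 3 (Suc k)) / vnorm (W 3 k))) \<le> ereal (cmod \<mu>)))"
proof -
  have drift': "\<forall>r. (qbd_block a b 1 \<triangleright> rones) r < (qbd_block a b (-1) \<triangleright> rones) r"
    using drift by (simp add: A_eq)
  obtain \<theta> where "qbd A \<theta>"
    using qbd_qbd_block[OF a_nonneg b_nonneg a_sum b_sum drift'] A_eq by metis
  then interpret qbd A \<theta> .
  have st: "\<forall>i\<in>{1, 2, 3}. stochastic (X i k)" for k
    by (induction k)
      (use X_init X_step1 X_step2 X_step3 F1_stochastic F2_stochastic F3_stochastic
        in \<open>auto simp: stochastic_def\<close>)
  have sol: "nonneg_solution A G" using G_min by (simp add: minimal_nonneg_solution_def)
  note G_Linf = minimal_solution_substochastic(1)[OF G_min]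
  have G_st: "stochastic G"
    by (rule solution_stochastic[OF sol minimal_solution_substochastic[OF G_min]])
  have G_fix: "F1 A G = G" using sol nonneg_solution_iff[OF G_Linf] by blast
  \<comment> \<open>\<open>assms(7)\<close> is the strict drift condition of the theorem, weakened
    to the entrywise order.\<close>
  have le: "A 1 \<triangleright> rones \<le> A (-1) \<triangleright> rones"
    unfolding le_fun_def using assms(7) by (blast intro: less_imp_le)
  have units: "mat_id - A 0 \<in> Units Linf_monoid"
    "\<forall>k. mat_id - A 0 - A 1 \<star> X 3 k \<in> Units Linf_monoid"
    using unit_A0 unit_A0_A1(1) st by simp_all
  have X_Linf: "\<forall>i\<in>{1, 2, 3}. \<forall>k. X i k \<in> Linf"
    using st stochastic_Linf by blast
  have X_ones: "\<forall>i\<in>{1, 2, 3}. \<forall>k. 0 \<le> X i k \<and> X i k \<triangleright> rones = ones"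
    using st unfolding stochastic_def by blast
  have E_ones: "\<forall>i\<in>{1, 2, 3}. \<forall>k. G - X i k \<in> Linf \<and> (G - X i k) \<triangleright> rones = 0"
  proof (intro ballI allI conjI)
    fix i k assume i: "i \<in> {1, 2, 3::nat}"
    have X: "X i k \<in> Linf" "X i k \<triangleright> rones = ones" using i X_Linf X_ones by blast+
    show "G - X i k \<in> Linf" by (intro Linf_diff G_Linf X)
    show "(G - X i k) \<triangleright> rones = 0"
      by (simp only: mat_vec_diff_left[OF G_Linf X(1) ones_ell_inf] stochastic_vec[OF G_st] X(2) diff_self)
  qed
  have err: "(\<forall>k. vnorm ((G - X 1 (Suc k)) \<triangleright> w) \<le> mnorm (H1 A \<mu>) * vnorm ((G - X 1 k) \<triangleright> w)) \<and>
      (\<forall>k. vnorm ((G - X 2 (Suc k)) \<triangleright> w) \<le> mnorm (H2 A \<mu>) * vnorm ((G - X 2 k) \<triangleright> w)) \<and>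
      (\<forall>k. vnorm ((G - X 3 (Suc k)) \<triangleright> w) \<le>
        cmod \<mu> * mnorm (inv\<^bsub>Linf_monoid\<^esub> (mat_id - A 0 - A 1 \<star> X 3 k) \<star> A 1) * vnorm ((G - X 3 k) \<triangleright> w)) \<and>
      limsup (\<lambda>k. ereal (vnorm ((G - X 3 (Suc k)) \<triangleright> w) / vnorm ((G - X 3 k) \<triangleright> w))) \<le> ereal (cmod \<mu>)"
    if w: "w \<in> ell_inf" and eig: "G \<triangleright> w = (\<lambda>r. \<mu> * w r)" for w :: "nat \<Rightarrow> complex" and \<mu>
  proof -
    interpret qbd_eigenvector A \<theta> G w \<mu>
      by unfold_locales (use G_st G_fix w eig in auto)
    have b3: "vnorm ((G - X 3 (Suc k)) \<triangleright> w) \<le>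
        cmod \<mu> * mnorm (inv\<^bsub>Linf_monoid\<^esub> (mat_id - A 0 - A 1 \<star> X 3 k) \<star> A 1) * vnorm ((G - X 3 k) \<triangleright> w)" for k
      using F3_error[of "X 3 k"] st X_step3 by simp
    \<comment> \<open>By \<open>inv_A1_mnorm_le\<close> the matrix norm in \<open>b3\<close> is at
      most 1, so every single quotient is at most |\<mu>| and the limsup bound follows.\<close>
    have ratio: "vnorm ((G - X 3 (Suc k)) \<triangleright> w) / vnorm ((G - X 3 k) \<triangleright> w) \<le> cmod \<mu>" for k
    proof -
      have nn: "0 \<le> vnorm ((G - X 3 k) \<triangleright> w)"
        using E_ones by (intro vnorm_nonneg mat_vec_ell_inf w) simp
      have "cmod \<mu> * mnorm (inv\<^bsub>Linf_monoid\<^esub> (mat_id - A 0 - A 1 \<star> X 3 k) \<star> A 1) \<le> cmod \<mu> * 1"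
        using st inv_A1_mnorm_le[OF _ le] by (intro mult_left_mono) simp_all
      then have "vnorm ((G - X 3 (Suc k)) \<triangleright> w) \<le> cmod \<mu> * 1 * vnorm ((G - X 3 k) \<triangleright> w)"
        using b3[of k] mult_right_mono nn order_trans by blast
      \<comment> \<open>A quotient with denominator 0 has the default value 0, which is also at most
        |\<mu>|.\<close>
      then show ?thesis using nn by (cases "vnorm ((G - X 3 k) \<triangleright> w) = 0") (simp_all add: divide_le_eq)
    qed
    show ?thesis
      using F1_error F2_error st X_step1 X_step2 b3
      by (auto intro!: Limsup_bounded always_eventually ratio)
  qed
  show ?thesis
    unfolding Let_def
    by (rule conjI[OF conjI[OF units(1) conjI[OF units(2) X_Linf]] conjI[OF X_ones conjI[OF E_ones]]],
        intro allI impI, elim conjE, rule err)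
qed

end
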